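(* Let $P=([l],E)$ be an $r$-pattern with $E\neq\emptyset$, let $\alpha>1$, and for each $n$ let $G_n$ be a $P$-colorable $r$-graph on $n$ vertices with $\lambda^{(\alpha)}(G_n)=\lambda^{(\alpha)}(\mathrm{Col}(P),n)$. Then there exist $n_1\in\mathbb{N}$ and a constant $M>0$ such that for every $n\ge n_1$ the following hold: (1) $\lambda^{(\alpha)}(G_{n+1})\ \ge\ \Big(1+r\Big(1-\frac1\alpha-\frac{l}{\alpha(n-lr+l)}\Big)\big(x_{\min}(G_n)\big)^{\alpha}\Big)\lambda^{(\alpha)}(G_n)$; (2) $\big(x_{\min}(G_n)\big)^{\alpha}\ \ge\ \frac1n\Big(1-\frac{\hat\pi(\mathrm{Col}(P))\,M}{rn}\Big)$; (3) $\delta(G_n)\ \ge\ \hat\pi(\mathrm{Col}(P))\Big(1-\frac{M}{n}\Big)\binom{n}{r-1}$.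
   Context: An $r$-graph is a finite $r$-uniform hypergraph; $e(G)$ is its number of edges and $\delta(G)$ its minimum degree (the degree of $v$ is the number of edges containing $v$). For an $r$-graph $G$ with vertex set $[n]$ let $P_G(\mathbf{x})=r!\sum_{\{i_1,\dots,i_r\}\in E(G)}x_{i_1}\cdots x_{i_r}$. For $\alpha\ge1$ the $\alpha$-spectral radius is $\lambda^{(\alpha)}(G)=\max\{P_G(\mathbf{x}):\mathbf{x}\in\mathbb{R}^n,\ \|\mathbf{x}\|_\alpha=1\}$, where $\|\mathbf{x}\|_\alpha=(|x_1|^\alpha+\dots+|x_n|^\alpha)^{1/\alpha}$. A principal eigenvector of $G$ (for $\lambda^{(\alpha)}(G)$) is a nonnegative vector $\mathbf{x}$ with $\|\mathbf{x}\|_\alpha=1$ and $P_G(\mathbf{x})=\lambda^{(\alpha)}(G)$. Define $x_{\min}(G)$ (which depends on $\alpha$) as the infimum, over all principal eigenvectors $\mathbf{x}$ of $G$, of the minimum component of $\mathbf{x}$. An $r$-pattern is a pair $P=([l],E)$ with $l$ a positive integer and $E$ a set of $r$-multisets (multisets of cardinality $r$) with elements from $[l]$. An $r$-graph $H$ is $P$-colorable if there is a map $\phi:V(H)\to[l]$ such that for every edge $\{v_1,\dots,v_r\}\in E(H)$ the multiset $\{\phi(v_1),\dots,\phi(v_r)\}$ belongs to $E$. $\mathrm{Col}(P)$ is the family of all $P$-colorable $r$-graphs. For $\mathcal{P}=\mathrm{Col}(P)$: $\lambda^{(\alpha)}(\mathcal{P},n)$ is the maximum of $\lambda^{(\alpha)}(G)$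 over $n$-vertex $G\in\mathcal{P}$, $ex(\mathcal{P},n)$ is the maximum of $e(G)$ over $n$-vertex $G\in\mathcal{P}$, and $\hat\pi(\mathcal{P})=\lim_{n\to\infty}ex(\mathcal{P},n)/\binom nr$ (the limit exists). *)

theory Defs
  imports Complex_Main "HOL-Library.Multiset"
begin

record 'v hypergraph =
  verts :: "'v set"
  edges :: "'v set set"

definition rgraph :: "nat \<Rightarrow> 'v hypergraph \<Rightarrow> bool" where
  "rgraph r G \<longleftrightarrow> finite (verts G) \<and> (\<forall>e\<in>edges G. e \<subseteq> verts G \<and> card e = r)"

definition num_edges :: "'v hypergraph \<Rightarrow> nat" where
  "num_edges G = card (edges G)"

definition vdegree :: "'v hypergraph \<Rightarrow> 'v \<Rightarrow> nat" where
  "vdegree G v = card {e \<in> edges G. v \<in> e}"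

definition min_degree :: "'v hypergraph \<Rightarrow> nat" where
  "min_degree G = Min (vdegree G ` verts G)"

(* Vectors indexed by the vertices are functions on the whole vertex type; every
   notion below depends only on their values on verts G. *)

definition poly_form :: "nat \<Rightarrow> 'v hypergraph \<Rightarrow> ('v \<Rightarrow> real) \<Rightarrow> real" where
  "poly_form r G x = fact r * (\<Sum>e\<in>edges G. \<Prod>v\<in>e. x v)"

definition lnorm :: "real \<Rightarrow> 'v set \<Rightarrow> ('v \<Rightarrow> real) \<Rightarrow> real" where
  "lnorm \<alpha> V x = (\<Sum>v\<in>V. \<bar>x v\<bar> powr \<alpha>) powr (1 / \<alpha>)"

(* The supremum is a maximum by compactness of the unit sphere if verts G is
   finite and nonempty. *)
definition spec_radius :: "nat \<Rightarrow> real \<Rightarrow> 'v hypergraph \<Rightarrow> real" where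
  "spec_radius r \<alpha> G = Sup {poly_form r G x | x. lnorm \<alpha> (verts G) x = 1}"

definition principal_eigenvector ::
    "nat \<Rightarrow> real \<Rightarrow> 'v hypergraph \<Rightarrow> ('v \<Rightarrow> real) \<Rightarrow> bool" where
  "principal_eigenvector r \<alpha> G x \<longleftrightarrow>
     (\<forall>v\<in>verts G. 0 \<le> x v) \<and> lnorm \<alpha> (verts G) x = 1 \<and>
     poly_form r G x = spec_radius r \<alpha> G"

definition x_min :: "nat \<Rightarrow> real \<Rightarrow> 'v hypergraph \<Rightarrow> real" where
  "x_min r \<alpha> G = Inf {Min (x ` verts G) | x. principal_eigenvector r \<alpha> G x}"

type_synonym pattern = "nat \<times> nat multiset set"

definition is_pattern :: "nat \<Rightarrow> pattern \<Rightarrow> bool" where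
  "is_pattern r P \<longleftrightarrow> 1 \<le> fst P \<and> (\<forall>m\<in>snd P. size m = r \<and> set_mset m \<subseteq> {1..fst P})"

definition colorable :: "pattern \<Rightarrow> 'v hypergraph \<Rightarrow> bool" where
  "colorable P H \<longleftrightarrow>
     (\<exists>\<phi>. (\<forall>v\<in>verts H. \<phi> v \<in> {1..fst P}) \<and>
          (\<forall>e\<in>edges H. image_mset \<phi> (mset_set e) \<in> snd P))"

(* Vertices are natural numbers, which contains a copy of every finite r-graph;
   the vertex set may be any finite set of naturals. *)
definition Col :: "nat \<Rightarrow> pattern \<Rightarrow> nat hypergraph set" where
  "Col r P = {H. rgraph r H \<and> colorable P H}"

(* For a family of r-graphs closed under isomorphism the set below is finite,
   since there are finitely many r-graphs on n vertices up to isomorphism. *)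
definition spec_radius_fam :: "nat \<Rightarrow> real \<Rightarrow> nat hypergraph set \<Rightarrow> nat \<Rightarrow> real" where
  "spec_radius_fam r \<alpha> F n = Sup {spec_radius r \<alpha> G | G. G \<in> F \<and> card (verts G) = n}"

definition ex_num :: "nat hypergraph set \<Rightarrow> nat \<Rightarrow> nat" where
  "ex_num F n = Max {num_edges G | G. G \<in> F \<and> card (verts G) = n}"

definition pi_hat :: "nat \<Rightarrow> nat hypergraph set \<Rightarrow> real" where
  "pi_hat r F = lim (\<lambda>n. real (ex_num F n) / real (n choose r))"

end

theory Submission
  imports Defs "HOL-Analysis.Function_Topology" "HOL-Combinatorics.Transposition"
begin

text \<open>Write \<open>\<lambda>\<^sub>n\<close> for the maximal spectral radius on \<open>n\<close> vertices and \<open>t\<close> for the smallest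
  value of \<open>x\<^sub>u\<^sup>\<alpha>\<close>. Deleting a vertex of smallest weight bounds \<open>\<lambda>\<^sub>n\<^sub>-\<^sub>1 / \<lambda>\<^sub>n\<close> from below in
  terms of \<open>t\<close>; cloning a vertex of largest weight bounds it from above by the value that
  corresponds to \<open>t = 1/n\<close>, up to a factor \<open>1 + O(1/n\<^sup>2)\<close>. Comparing the two gives (2).
  For (1), the eigenvector is constant on the colour classes of the completed coloured graph, so
  one may add a vertex to a class of size at least \<open>n/l\<close>; the gain is controlled by the mean number
  of vertices that a weighted edge has in the class. For (3), the entries \<open>n x\<^sub>u\<^sup>\<alpha>\<close> have bounded total
  deviation from 1 by (2), so the eigenvalue equation at \<open>v\<close> estimates the degree of \<open>v\<close>.\<close>

section \<open>The form of an \<open>r\<close>-graph and its maximizers\<close>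

text \<open>For (2), deletion and cloning combine to \<open>(1 - r*t) * (1 + r/(n-1)) \<le> ((1 +
  1/(n-1)) * (1 - t)) powr (r/\<alpha>)\<close>. Put \<open>t = 1/n - d\<close>. At
  \<open>d = 0\<close> the right side is exactly 1 and the left side is within O(1/n^2) of 1. To
  first order in \<open>d\<close> the left side grows with slope \<open>r\<close> and the right side
  with slope \<open>r/\<alpha>\<close>; since \<alpha> > 1 these slopes differ, which forces
  \<open>d\<close> to be O(1/n^2). Principal eigenvectors are a priori only nonnegative, and the
  eigenvalue equation is derived at positive entries. Hence (2) precedes (1): it makes all entries
  positive for large \<open>n\<close>, and then the equations at two vertices of one colour force
  equal weights. The obstacle in (1) is that a pattern may repeat a colour inside an edge. If edges
  meet the class in more than one vertex on average, averaging the links of its vertices bounds the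
  gain of a new vertex too weakly; a variance estimate supplies the rest. The correction
  \<open>l / (\<alpha> * (n - l*r + l))\<close> bounds \<open>1 / (\<alpha> * (s - r + 1))\<close>
  for a class of size \<open>s \<ge> n/l\<close>.\<close>

lemma rgraph_finite_edges: "rgraph r G \<Longrightarrow> finite (edges G)"
  unfolding rgraph_def by (meson Pow_iff finite_Pow_iff finite_subset subsetI)

lemma rgraph_edgeD:
  assumes "rgraph r G" "e \<in> edges G"
  shows "finite e" "e \<subseteq> verts G" "card e = r"
  using assms finite_subset unfolding rgraph_def by auto

lemma rgraph_num_edges_le:
  assumes "rgraph r G"
  shows "num_edges G \<le> card (verts G) choose r"
proof -
  have "num_edges G \<le> card {e. e \<subseteq> verts G \<and> card e = r}"
    unfolding num_edges_def using assms
    by (intro card_mono) (auto simp: rgraph_def)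
  thus ?thesis using assms by (simp add: n_subsets rgraph_def)
qed

lemma lnorm_eq_1_iff:
  assumes "\<alpha> > 0"
  shows "lnorm \<alpha> V x = 1 \<longleftrightarrow> (\<Sum>v\<in>V. \<bar>x v\<bar> powr \<alpha>) = 1"
proof
  assume "lnorm \<alpha> V x = 1"
  hence "((\<Sum>v\<in>V. \<bar>x v\<bar> powr \<alpha>) powr (1 / \<alpha>)) powr \<alpha> = 1 powr \<alpha>"
    by (simp add: lnorm_def)
  thus "(\<Sum>v\<in>V. \<bar>x v\<bar> powr \<alpha>) = 1"
    using assms by (simp add: powr_powr sum_nonneg)
qed (simp add: lnorm_def)

lemma abs_le_1_if_lnorm_1:
  assumes "\<alpha> > 0" "finite V" "lnorm \<alpha> V x = 1" "v \<in> V"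
  shows "\<bar>x v\<bar> \<le> 1"
proof (rule ccontr)
  assume "\<not> \<bar>x v\<bar> \<le> 1"
  hence "1 < \<bar>x v\<bar> powr \<alpha>" using assms(1) by (intro gr_one_powr) auto
  also have "\<dots> \<le> (\<Sum>v\<in>V. \<bar>x v\<bar> powr \<alpha>)" using assms by (intro member_le_sum) auto
  finally show False using assms(3) unfolding lnorm_eq_1_iff[OF assms(1)] by simp
qed

lemma poly_form_le_num_edges:
  assumes "rgraph r G" "\<And>v. v \<in> verts G \<Longrightarrow> \<bar>x v\<bar> \<le> 1"
  shows "poly_form r G x \<le> fact r * real (num_edges G)"
proof -
  have "(\<Sum>e\<in>edges G. \<Prod>v\<in>e. x v) \<le> (\<Sum>e\<in>edges G. 1)"
  proof (rule sum_mono)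
    fix e assume e: "e \<in> edges G"
    have "(\<Prod>v\<in>e. x v) \<le> (\<Prod>v\<in>e. \<bar>x v\<bar>)" by (metis abs_ge_self abs_prod)
    also have "\<dots> \<le> (\<Prod>v\<in>e. 1)"
      using assms(2) rgraph_edgeD(2)[OF assms(1) e] by (intro prod_mono) auto
    finally show "(\<Prod>v\<in>e. x v) \<le> 1" by simp
  qed
  thus ?thesis by (simp add: poly_form_def num_edges_def)
qed

lemma poly_form_le_spec_radius:
  assumes "rgraph r G" "\<alpha> > 0" "lnorm \<alpha> (verts G) x = 1"
  shows "poly_form r G x \<le> spec_radius r \<alpha> G"
  unfolding spec_radius_def
proof (rule cSup_upper)
  show "bdd_above {poly_form r G x | x. lnorm \<alpha> (verts G) x = 1}"
    proof (rule bdd_aboveI)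
    fix p assume "p \<in> {poly_form r G x | x. lnorm \<alpha> (verts G) x = 1}"
    thus "p \<le> fact r * real (num_edges G)"
      using poly_form_le_num_edges[OF assms(1)] abs_le_1_if_lnorm_1[OF assms(2), of "verts G"] assms(1)
      unfolding rgraph_def by blast
  qed
qed (use assms in auto)

lemma poly_form_scale:
  assumes "rgraph r G"
  shows "poly_form r G (\<lambda>v. c * x v) = c ^ r * poly_form r G x"
proof -
  have "(\<Sum>e\<in>edges G. \<Prod>v\<in>e. c * x v) = (\<Sum>e\<in>edges G. c ^ r * (\<Prod>v\<in>e. x v))"
    using rgraph_edgeD[OF assms] by (intro sum.cong) (auto simp: prod.distrib)
  thus ?thesis by (simp add: poly_form_def sum_distrib_left mult_ac)
qed

lemma poly_form_nonneg:
  assumes "rgraph r G" "\<And>v. v \<in> verts G \<Longrightarrow> 0 \<le> x v"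
  shows "0 \<le> poly_form r G x"
  unfolding poly_form_def using assms rgraph_edgeD[OF assms(1)]
  by (intro mult_nonneg_nonneg sum_nonneg prod_nonneg) (auto simp: subset_iff)

text \<open>Homogeneity of degree \<open>r\<close> frees test vectors from normalisation; every
  later comparison of spectral radii uses this form. The zero vector cannot be rescaled, and there
  \<open>r \<ge> 1\<close> makes each edge nonempty, so the form vanishes.\<close>

lemma poly_form_le_homogeneous:
  assumes G: "rgraph r G" and "\<alpha> > 0" "r \<ge> 1"
  shows "poly_form r G x \<le>
    spec_radius r \<alpha> G * (\<Sum>v\<in>verts G. \<bar>x v\<bar> powr \<alpha>) powr (real r / \<alpha>)"
proof (cases "(\<Sum>v\<in>verts G. \<bar>x v\<bar> powr \<alpha>) = 0")
  case True
  hence x0: "x v = 0" if "v \<in> verts G" for v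
    using that G by (simp add: sum_nonneg_eq_0_iff rgraph_def)
  have "(\<Prod>v\<in>e. x v) = 0" if e: "e \<in> edges G" for e
  proof -
    have "e \<noteq> {}" using rgraph_edgeD[OF G e] assms(3) by auto
    thus ?thesis using rgraph_edgeD[OF G e] x0 by (auto intro!: prod_zero)
  qed
  thus ?thesis using True by (simp add: poly_form_def)
next
  case False
  define S where "S = (\<Sum>v\<in>verts G. \<bar>x v\<bar> powr \<alpha>)"
  define c where "c = S powr (- (1 / \<alpha>))"
  have S: "S > 0" using False by (simp add: S_def sum_nonneg order_less_le)
  have "(\<Sum>v\<in>verts G. \<bar>c * x v\<bar> powr \<alpha>) = (\<Sum>v\<in>verts G. S powr (-1) * \<bar>x v\<bar> powr \<alpha>)"
    using \<open>\<alpha> > 0\<close> by (intro sum.cong) (auto simp: c_def abs_mult powr_mult powr_powr)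
  also have "\<dots> = S powr (-1) * S" by (simp add: S_def sum_distrib_left)
  also have "\<dots> = 1" using S by (simp add: powr_minus)
  finally have "lnorm \<alpha> (verts G) (\<lambda>v. c * x v) = 1" using assms lnorm_eq_1_iff by blast
  hence "c ^ r * poly_form r G x \<le> spec_radius r \<alpha> G"
    using poly_form_le_spec_radius[OF G \<open>\<alpha> > 0\<close>] poly_form_scale[OF G] by metis
  hence "S powr (real r / \<alpha>) * (c ^ r * poly_form r G x) \<le> S powr (real r / \<alpha>) * spec_radius r \<alpha> G"
    by (intro mult_left_mono) auto
  moreover have "S powr (real r / \<alpha>) * c ^ r = 1"
    using S by (simp add: c_def powr_realpow[symmetric] powr_powr flip: powr_add)
  ultimately show ?thesis by (simp flip: S_def mult.assoc) (simp add: mult.commute)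
qed

text \<open>Compactness argument. The vertex type may be infinite, so coordinates outside
  \<open>verts G\<close> are pinned to 0 and the box \<open>B\<close> is compact as a product.
  Maximizing over nonnegative vectors is enough because passing to absolute values does not decrease
  the form.\<close>

lemma exists_principal_eigenvector:
  fixes G :: "'v hypergraph"
  assumes G: "rgraph r G" and "verts G \<noteq> {}" "\<alpha> > 0"
  shows "\<exists>x. principal_eigenvector r \<alpha> G x"
proof -
  have fin: "finite (verts G)" using G by (simp add: rgraph_def)
  define B :: "('v \<Rightarrow> real) set" where "B = PiE UNIV (\<lambda>v. if v \<in> verts G then {0..1} else {0})"
  define C where "C = {x \<in> B. (\<Sum>v\<in>verts G. x v powr \<alpha>) = 1}"
  have "compactin (product_topology (\<lambda>_. euclidean) UNIV) B"
    unfolding B_def by (subst compactin_PiE) auto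
  hence "compact B" by (simp add: euclidean_product_topology)
  have cont: "continuous_on A (\<lambda>x. x v)" for A :: "('v \<Rightarrow> real) set" and v
    by (rule continuous_on_subset[OF continuous_on_product_coordinates]) simp
  have nonneg: "x v \<ge> 0" if "x \<in> B" for x v
    using that by (auto simp: B_def PiE_iff split: if_splits dest: spec[of _ v])
  have "continuous_on B (\<lambda>x. \<Sum>v\<in>verts G. x v powr \<alpha>)"
    using nonneg \<open>\<alpha> > 0\<close>
    by (intro continuous_on_sum continuous_on_powr' cont continuous_on_const) auto
  hence "closedin (top_of_set B) C"
    unfolding C_def by (rule continuous_closedin_preimage_constant)
  hence "compact C" using \<open>compact B\<close> closedin_compact by blast
  obtain u where u: "u \<in> verts G" using assms by blast
  have "(\<lambda>v. if v = u then 1 else 0) \<in> C"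
    using u fin \<open>\<alpha> > 0\<close> by (auto simp: C_def B_def if_distrib[of "\<lambda>t. t powr \<alpha>"] cong: if_cong)
  hence "C \<noteq> {}" by blast
  moreover have "continuous_on C (poly_form r G)"
    unfolding poly_form_def
    by (intro continuous_on_mult continuous_on_const continuous_on_sum continuous_on_prod cont)
  ultimately obtain y where y: "y \<in> C" "\<And>x. x \<in> C \<Longrightarrow> poly_form r G x \<le> poly_form r G y"
    using continuous_attains_sup[OF \<open>compact C\<close>] by metis
  have y0: "y v \<ge> 0" for v using y nonneg by (auto simp: C_def)
  have ly: "lnorm \<alpha> (verts G) y = 1"
    using y(1) y0 \<open>\<alpha> > 0\<close> by (simp add: lnorm_eq_1_iff C_def)
  have "poly_form r G x \<le> poly_form r G y" if x: "lnorm \<alpha> (verts G) x = 1" for x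
  proof -
    define z where "z = (\<lambda>v. if v \<in> verts G then \<bar>x v\<bar> else 0)"
    have "(\<Prod>v\<in>e. x v) \<le> (\<Prod>v\<in>e. z v)" if e: "e \<in> edges G" for e
    proof -
      have "(\<Prod>v\<in>e. z v) = (\<Prod>v\<in>e. \<bar>x v\<bar>)"
        using rgraph_edgeD[OF G e] by (intro prod.cong) (auto simp: z_def)
      thus ?thesis by (metis abs_ge_self abs_prod)
    qed
    hence "poly_form r G x \<le> poly_form r G z"
      unfolding poly_form_def by (intro mult_left_mono sum_mono) auto
    also have "z \<in> C"
      using abs_le_1_if_lnorm_1[OF \<open>\<alpha> > 0\<close> fin x] x \<open>\<alpha> > 0\<close>
      by (auto simp: C_def B_def z_def lnorm_eq_1_iff)
    hence "poly_form r G z \<le> poly_form r G y" by (rule y)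
    finally show ?thesis .
  qed
  hence "spec_radius r \<alpha> G = poly_form r G y"
    unfolding spec_radius_def using ly by (intro cSup_eq_maximum) auto
  thus ?thesis using y0 ly unfolding principal_eigenvector_def by metis
qed

section \<open>Partial derivatives of the multilinear form, the eigenvalue equation and Euler's
  identity\<close>

definition poly_deriv :: "nat \<Rightarrow> 'v hypergraph \<Rightarrow> 'v \<Rightarrow> ('v \<Rightarrow> real) \<Rightarrow> real" where
  "poly_deriv r G v x = fact r * (\<Sum>e\<in>{e \<in> edges G. v \<in> e}. \<Prod>u\<in>e - {v}. x u)"

lemma poly_form_split:
  assumes G: "rgraph r G"
  shows "poly_form r G x = poly_form r G (x(v := 0)) + x v * poly_deriv r G v x"
proof -
  have fe: "finite (edges G)" using rgraph_finite_edges[OF G] .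
  have sp: "(\<Sum>e\<in>edges G. \<Prod>v\<in>e. y v) =
      (\<Sum>e\<in>{e \<in> edges G. v \<notin> e}. \<Prod>v\<in>e. y v) + (\<Sum>e\<in>{e \<in> edges G. v \<in> e}. \<Prod>v\<in>e. y v)"
    for y :: "'a \<Rightarrow> real"
    using fe by (subst sum.union_disjoint[symmetric]) (auto intro!: sum.cong)
  have 1: "(\<Sum>e\<in>{e \<in> edges G. v \<in> e}. \<Prod>v\<in>e. y v) =
      (\<Sum>e\<in>{e \<in> edges G. v \<in> e}. y v * (\<Prod>v\<in>e - {v}. y v))" for y :: "'a \<Rightarrow> real"
    using rgraph_edgeD[OF G] by (intro sum.cong) (auto simp: prod.remove)
  have 2: "(\<Sum>e\<in>{e \<in> edges G. v \<notin> e}. \<Prod>u\<in>e. (x(v := 0)) u) =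
      (\<Sum>e\<in>{e \<in> edges G. v \<notin> e}. \<Prod>u\<in>e. x u)"
    by (intro sum.cong prod.cong) auto
  show ?thesis
    unfolding poly_form_def poly_deriv_def sp[of x] sp[of "x(v := 0)"] 1 2
    by (simp add: sum_distrib_left algebra_simps)
qed

lemma poly_deriv_upd [simp]: "poly_deriv r G v (x(v := s)) = poly_deriv r G v x"
  unfolding poly_deriv_def by (intro arg_cong[where f = "(*) _"] sum.cong prod.cong) auto

lemma poly_form_upd:
  assumes "rgraph r G"
  shows "poly_form r G (x(v := s)) = poly_form r G (x(v := 0)) + s * poly_deriv r G v x"
  using poly_form_split[OF assms, of "x(v := s)" v] by simp

lemma principal_eigenvectorD:
  assumes "principal_eigenvector r \<alpha> G x" "\<alpha> > 0"
  shows "\<And>v. v \<in> verts G \<Longrightarrow> 0 \<le> x v" "(\<Sum>v\<in>verts G. x v powr \<alpha>) = 1"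
    "poly_form r G x = spec_radius r \<alpha> G"
proof -
  show 0: "\<And>v. v \<in> verts G \<Longrightarrow> 0 \<le> x v" and "poly_form r G x = spec_radius r \<alpha> G"
    using assms by (auto simp: principal_eigenvector_def)
  have "(\<Sum>v\<in>verts G. \<bar>x v\<bar> powr \<alpha>) = 1"
    using assms unfolding principal_eigenvector_def lnorm_eq_1_iff[OF assms(2)] by blast
  moreover have "(\<Sum>v\<in>verts G. \<bar>x v\<bar> powr \<alpha>) = (\<Sum>v\<in>verts G. x v powr \<alpha>)"
    using 0 by (intro sum.cong) auto
  ultimately show "(\<Sum>v\<in>verts G. x v powr \<alpha>) = 1" by simp
qed

text \<open>No Lagrange multiplier is needed: \<open>h s\<close> is the defect of the homogeneous
  inequality when the entry at \<open>v\<close> is changed to \<open>s\<close>. It is nonnegative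
  for \<open>s > 0\<close> and zero at \<open>x v\<close>, so its derivative vanishes there.
  Positivity of \<open>x v\<close> places this minimum inside the range where
  \<open>s powr \<alpha>\<close> is differentiable.\<close>

lemma eigen_equation:
  assumes G: "rgraph r G" and x: "principal_eigenvector r \<alpha> G x"
    and "\<alpha> > 0" "r \<ge> 1" and v: "v \<in> verts G" "x v > 0"
  shows "poly_deriv r G v x = real r * spec_radius r \<alpha> G * x v powr (\<alpha> - 1)"
proof -
  note px = principal_eigenvectorD[OF x \<open>\<alpha> > 0\<close>]
  have fin: "finite (verts G)" using G by (simp add: rgraph_def)
  define \<Lambda> S A D where "\<Lambda> = spec_radius r \<alpha> G" and "S = (\<Sum>u\<in>verts G - {v}. x u powr \<alpha>)"
    and "A = poly_form r G (x(v := 0))" and "D = poly_deriv r G v x"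
  have S1: "S + x v powr \<alpha> = 1" using px(2) fin v by (simp add: S_def sum.remove[of _ v])
  define h where "h s = \<Lambda> * (S + s powr \<alpha>) powr (real r / \<alpha>) - (A + s * D)" for s
  have hv: "h (x v) = 0"
    using poly_form_split[OF G, of x v] px(3) S1 by (simp add: h_def \<Lambda>_def A_def D_def)
  have "h s \<ge> 0" if "s > 0" for s
  proof -
    have "(\<Sum>u\<in>verts G. \<bar>(x(v := s)) u\<bar> powr \<alpha>) = S + s powr \<alpha>"
      using fin v that px(1) by (simp add: S_def sum.remove[of _ v])
    thus ?thesis
      using poly_form_le_homogeneous[OF G \<open>\<alpha> > 0\<close> \<open>r \<ge> 1\<close>, of "x(v := s)"] poly_form_upd[OF G, of x v s]
      by (simp add: h_def \<Lambda>_def A_def D_def)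
  qed
  hence min: "h (x v) \<le> h s" if "\<bar>x v - s\<bar> < x v" for s using that hv v by (simp add: abs_if split: if_splits)
  have "(h has_real_derivative (\<Lambda> * (real r / \<alpha> * (\<alpha> * x v powr (\<alpha> - 1))) - D)) (at (x v))"
    unfolding h_def using v S1 \<open>\<alpha> > 0\<close>
    by (auto intro!: derivative_eq_intros DERIV_powr simp del: mult_eq_0_iff)
  hence "\<Lambda> * (real r / \<alpha> * (\<alpha> * x v powr (\<alpha> - 1))) - D = 0"
    using DERIV_local_min[of h _ "x v" "x v"] v min by blast
  thus ?thesis using \<open>\<alpha> > 0\<close> by (simp add: \<Lambda>_def D_def algebra_simps)
qed

text \<open>Double counting of pairs of a vertex in \<open>A\<close> and an edge through it. With
  \<open>A\<close> the whole vertex set it yields Euler's identity; with \<open>A\<close> a colour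
  class it yields the weighted first moment of the intersection size.\<close>

lemma sum_poly_deriv:
  assumes G: "rgraph r G" and "finite A"
  shows "(\<Sum>v\<in>A. x v * poly_deriv r G v x) =
    fact r * (\<Sum>e\<in>edges G. real (card (e \<inter> A)) * (\<Prod>u\<in>e. x u))"
proof -
  have "(\<Sum>v\<in>A. x v * poly_deriv r G v x) =
      fact r * (\<Sum>v\<in>A. \<Sum>e\<in>{e \<in> edges G. v \<in> e}. \<Prod>u\<in>e. x u)"
    unfolding poly_deriv_def sum_distrib_left
    using rgraph_edgeD[OF G] by (intro sum.cong) (auto simp: prod.remove)
  also have "(\<Sum>v\<in>A. \<Sum>e\<in>{e \<in> edges G. v \<in> e}. \<Prod>u\<in>e. x u) =
      (\<Sum>e\<in>edges G. \<Sum>v\<in>{v \<in> A. v \<in> e}. \<Prod>u\<in>e. x u)"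
    by (rule sum.swap_restrict[OF assms(2) rgraph_finite_edges[OF G]])
  also have "\<dots> = (\<Sum>e\<in>edges G. real (card (e \<inter> A)) * (\<Prod>u\<in>e. x u))"
    by (intro sum.cong) (auto simp: Int_def conj_commute)
  finally show ?thesis .
qed

lemma euler_identity:
  assumes G: "rgraph r G"
  shows "(\<Sum>v\<in>verts G. x v * poly_deriv r G v x) = real r * poly_form r G x"
proof -
  have "card (e \<inter> verts G) = r" if "e \<in> edges G" for e
    using rgraph_edgeD[OF G that] by (simp add: Int_absorb2)
  thus ?thesis using sum_poly_deriv[OF G] G
    by (simp add: rgraph_def poly_form_def sum_distrib_left mult_ac)
qed

lemma poly_form_one: "poly_form r G (\<lambda>_. 1) = fact r * real (num_edges G)"
  by (simp add: poly_form_def num_edges_def)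

lemma poly_deriv_one: "poly_deriv r G v (\<lambda>_. 1) = fact r * real (vdegree G v)"
  by (simp add: poly_deriv_def vdegree_def)

lemma sum_vdegree:
  assumes "rgraph r G"
  shows "(\<Sum>v\<in>verts G. real (vdegree G v)) = real r * real (num_edges G)"
proof -
  have "fact r * (\<Sum>v\<in>verts G. real (vdegree G v)) = fact r * (real r * real (num_edges G))"
    using euler_identity[OF assms, of "\<lambda>_. 1"]
    by (simp add: poly_form_one poly_deriv_one sum_distrib_left mult_ac)
  thus ?thesis by simp
qed

lemma num_edges_le_spec_radius:
  assumes "rgraph r G" "\<alpha> > 0" "r \<ge> 1"
  shows "fact r * real (num_edges G) \<le> spec_radius r \<alpha> G * real (card (verts G)) powr (r / \<alpha>)"
  using poly_form_le_homogeneous[OF assms, of "\<lambda>_. 1"] by (simp add: poly_form_one)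

text \<open>The values of the form at \<open>x\<close> and the two spectral radii are squeezed: the
  form of \<open>G\<close> at \<open>x\<close> is at most that of \<open>H\<close>, hence at most
  the radius of \<open>H\<close>, which is at most that of \<open>G\<close>, where the chain
  began.\<close>

lemma principal_eigenvector_supergraph:
  assumes G: "rgraph r G" and H: "rgraph r H" and "verts H = verts G" "edges G \<subseteq> edges H"
    and "\<alpha> > 0" "spec_radius r \<alpha> H \<le> spec_radius r \<alpha> G" and x: "principal_eigenvector r \<alpha> G x"
  shows "principal_eigenvector r \<alpha> H x" "spec_radius r \<alpha> H = spec_radius r \<alpha> G"
proof -
  have nn: "\<And>v. v \<in> verts G \<Longrightarrow> 0 \<le> x v" using x by (simp add: principal_eigenvector_def)
  have "poly_form r G x \<le> poly_form r H x"
    unfolding poly_form_def using assms(3,4) rgraph_finite_edges[OF H] nn rgraph_edgeD(2)[OF H]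
    by (intro mult_left_mono sum_mono2) (auto intro!: prod_nonneg nn simp: subset_iff)
  moreover have "poly_form r H x \<le> spec_radius r \<alpha> H"
    using poly_form_le_spec_radius[OF H \<open>\<alpha> > 0\<close>] x assms(3) by (simp add: principal_eigenvector_def)
  moreover have "poly_form r G x = spec_radius r \<alpha> G" using x by (simp add: principal_eigenvector_def)
  ultimately show "principal_eigenvector r \<alpha> H x" "spec_radius r \<alpha> H = spec_radius r \<alpha> G"
    using x assms(3,6) by (simp_all add: principal_eigenvector_def)
qed

section \<open>Complete coloured graphs\<close>

definition col_edges :: "nat \<Rightarrow> nat multiset set \<Rightarrow> ('v \<Rightarrow> nat) \<Rightarrow> 'v set \<Rightarrow> 'v set set" where
  "col_edges r E \<phi> V = {e. e \<subseteq> V \<and> card e = r \<and> image_mset \<phi> (mset_set e) \<in> E}"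

text \<open>The link that a vertex of colour \<open>i\<close> outside \<open>V\<close> would
  acquire; no such vertex has to exist. Writing \<open>Suc (card f) = r\<close> instead of
  \<open>card f = r - 1\<close> makes the link empty for \<open>r = 0\<close>, so the insertion
  identities hold for every \<open>r\<close>.\<close>

definition col_link :: "nat \<Rightarrow> nat multiset set \<Rightarrow> ('v \<Rightarrow> nat) \<Rightarrow> nat \<Rightarrow> 'v set \<Rightarrow> 'v set set" where
  "col_link r E \<phi> i V =
     {f. f \<subseteq> V \<and> Suc (card f) = r \<and> add_mset i (image_mset \<phi> (mset_set f)) \<in> E}"

definition col_graph :: "nat \<Rightarrow> nat multiset set \<Rightarrow> ('v \<Rightarrow> nat) \<Rightarrow> 'v set \<Rightarrow> 'v hypergraph" where
  "col_graph r E \<phi> V = \<lparr>verts = V, edges = col_edges r E \<phi> V\<rparr>"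

lemma verts_col_graph [simp]: "verts (col_graph r E \<phi> V) = V"
  and edges_col_graph [simp]: "edges (col_graph r E \<phi> V) = col_edges r E \<phi> V"
  by (simp_all add: col_graph_def)

lemma rgraph_col_graph: "finite V \<Longrightarrow> rgraph r (col_graph r E \<phi> V)"
  by (auto simp: rgraph_def col_edges_def)

lemma finite_col_link: "finite V \<Longrightarrow> finite (col_link r E \<phi> i V)"
  unfolding col_link_def by (rule finite_subset[of _ "Pow V"]) auto

lemma col_link_mono: "U \<subseteq> V \<Longrightarrow> col_link r E \<phi> i U \<subseteq> col_link r E \<phi> i V"
  by (auto simp: col_link_def)

lemma col_link_Diff: "col_link r E \<phi> i (V - {v}) = {f \<in> col_link r E \<phi> i V. v \<notin> f}"
  by (auto simp: col_link_def)

lemma image_mset_mset_set_cong: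
  assumes "finite e" "\<And>v. v \<in> e \<Longrightarrow> \<phi> v = \<psi> v"
  shows "image_mset \<phi> (mset_set e) = image_mset \<psi> (mset_set e)"
  using assms by (intro image_mset_cong) auto

lemma col_edges_cong:
  assumes "finite V" "\<And>v. v \<in> V \<Longrightarrow> \<phi> v = \<psi> v"
  shows "col_edges r E \<phi> V = col_edges r E \<psi> V"
proof -
  have "image_mset \<phi> (mset_set e) = image_mset \<psi> (mset_set e)" if "e \<subseteq> V" for e
    using that assms finite_subset by (intro image_mset_mset_set_cong) auto
  thus ?thesis by (auto simp: col_edges_def)
qed

lemma col_link_cong:
  assumes "finite V" "\<And>v. v \<in> V \<Longrightarrow> \<phi> v = \<psi> v"
  shows "col_link r E \<phi> i V = col_link r E \<psi> i V"
proof -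
  have "image_mset \<phi> (mset_set e) = image_mset \<psi> (mset_set e)" if "e \<subseteq> V" for e
    using that assms finite_subset by (intro image_mset_mset_set_cong) auto
  thus ?thesis by (auto simp: col_link_def)
qed

lemma col_edges_containing:
  assumes "finite V" "v \<in> V"
  shows "{e \<in> col_edges r E \<phi> V. v \<in> e} = insert v ` col_link r E \<phi> (\<phi> v) (V - {v})"
proof (intro equalityI subsetI)
  fix e assume e: "e \<in> {e \<in> col_edges r E \<phi> V. v \<in> e}"
  hence fe: "finite e" and "v \<in> e" using assms finite_subset by (auto simp: col_edges_def)
  hence "mset_set e = add_mset v (mset_set (e - {v}))" "Suc (card (e - {v})) = card e"
    by (simp add: mset_set.remove) (rule card_Suc_Diff1[OF fe \<open>v \<in> e\<close>])
  hence "e - {v} \<in> col_link r E \<phi> (\<phi> v) (V - {v})"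
    using e by (auto simp: col_edges_def col_link_def)
  moreover have "e = insert v (e - {v})" using \<open>v \<in> e\<close> by blast
  ultimately show "e \<in> insert v ` col_link r E \<phi> (\<phi> v) (V - {v})" by blast
next
  fix e assume "e \<in> insert v ` col_link r E \<phi> (\<phi> v) (V - {v})"
  then obtain f where f: "f \<in> col_link r E \<phi> (\<phi> v) (V - {v})" "e = insert v f" by blast
  hence "finite f" "v \<notin> f" using assms finite_subset by (auto simp: col_link_def)
  thus "e \<in> {e \<in> col_edges r E \<phi> V. v \<in> e}"
    using f assms by (auto simp: col_edges_def col_link_def)
qed

lemma sum_col_edges_containing:
  assumes "finite V" "v \<in> V"
  shows "(\<Sum>e\<in>{e \<in> col_edges r E \<phi> V. v \<in> e}. g e) =
    (\<Sum>f\<in>col_link r E \<phi> (\<phi> v) (V - {v}). g (insert v f))"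
proof -
  have "inj_on (insert v) (col_link r E \<phi> (\<phi> v) (V - {v}))"
    by (rule inj_onI) (auto simp: col_link_def)
  thus ?thesis unfolding col_edges_containing[OF assms] by (simp add: sum.reindex)
qed

lemma poly_deriv_col_graph:
  assumes "finite V" "v \<in> V"
  shows "poly_deriv r (col_graph r E \<phi> V) v x =
    fact r * (\<Sum>f\<in>col_link r E \<phi> (\<phi> v) (V - {v}). \<Prod>u\<in>f. x u)"
proof -
  have "(\<Sum>f\<in>col_link r E \<phi> (\<phi> v) (V - {v}). \<Prod>u\<in>insert v f - {v}. x u) =
      (\<Sum>f\<in>col_link r E \<phi> (\<phi> v) (V - {v}). \<Prod>u\<in>f. x u)"
    by (intro sum.cong prod.cong) (auto simp: col_link_def)
  thus ?thesis by (simp add: poly_deriv_def sum_col_edges_containing[OF assms])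
qed

lemma poly_form_col_graph_insert:
  assumes "finite V" "u \<notin> V"
  shows "poly_form r (col_graph r E \<phi> (insert u V)) x = poly_form r (col_graph r E \<phi> V) x +
    x u * (fact r * (\<Sum>f\<in>col_link r E \<phi> (\<phi> u) V. \<Prod>v\<in>f. x v))"
proof -
  have "(\<Sum>e\<in>col_edges r E \<phi> (insert u V). \<Prod>v\<in>e. (x(u := 0)) v) =
      (\<Sum>e\<in>col_edges r E \<phi> V. \<Prod>v\<in>e. x v)"
  proof (rule sum.mono_neutral_cong_right)
    show "finite (col_edges r E \<phi> (insert u V))"
      using rgraph_finite_edges[OF rgraph_col_graph[of "insert u V" r E \<phi>]] assms by simp
    show "\<forall>e\<in>col_edges r E \<phi> (insert u V) - col_edges r E \<phi> V. (\<Prod>v\<in>e. (x(u := 0)) v) = 0"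
    proof
      fix e assume e: "e \<in> col_edges r E \<phi> (insert u V) - col_edges r E \<phi> V"
      hence "finite e" using assms finite_subset[of e "insert u V"] by (auto simp: col_edges_def)
      moreover have "u \<in> e" using e by (auto simp: col_edges_def)
      ultimately show "(\<Prod>v\<in>e. (x(u := 0)) v) = 0" by (intro prod_zero) auto
    qed
    show "(\<Prod>v\<in>e. (x(u := 0)) v) = (\<Prod>v\<in>e. x v)" if "e \<in> col_edges r E \<phi> V" for e
      using that assms by (intro prod.cong) (auto simp: col_edges_def)
  qed (auto simp: col_edges_def)
  hence "poly_form r (col_graph r E \<phi> (insert u V)) (x(u := 0)) = poly_form r (col_graph r E \<phi> V) x"
    by (simp add: poly_form_def)
  thus ?thesis
    using poly_form_split[OF rgraph_col_graph, of "insert u V" r E \<phi> x u] assms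
    by (simp add: poly_deriv_col_graph)
qed

lemma poly_form_col_graph_remove:
  assumes "finite V" "v \<in> V"
  shows "poly_form r (col_graph r E \<phi> V) x = poly_form r (col_graph r E \<phi> (V - {v})) x +
    x v * poly_deriv r (col_graph r E \<phi> V) v x"
  using poly_form_col_graph_insert[of "V - {v}" v r E \<phi> x] assms
  by (simp add: poly_deriv_col_graph insert_absorb)

lemma sum_col_link_Diff_le:
  assumes "finite V" "\<And>u. u \<in> V \<Longrightarrow> 0 \<le> x u"
  shows "(\<Sum>f\<in>col_link r E \<phi> i (V - {v}). \<Prod>u\<in>f. x u) \<le>
    (\<Sum>f\<in>col_link r E \<phi> i V. \<Prod>u\<in>f. (x u :: real))"
  using assms by (intro sum_mono2 finite_col_link prod_nonneg)
    (auto simp: col_link_def)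

lemma col_graph_in_Col:
  assumes "finite V" "\<phi> ` V \<subseteq> {1..l}"
  shows "col_graph r E \<phi> V \<in> Col r (l, E)"
  unfolding Col_def colorable_def using assms rgraph_col_graph[of V r E \<phi>]
  by (auto intro!: exI[of _ \<phi>] simp: col_edges_def)

lemma Col_rgraph: "G \<in> Col r P \<Longrightarrow> rgraph r G"
  by (simp add: Col_def)

lemma Col_coloringE:
  assumes "G \<in> Col r (l, E)"
  obtains \<phi> where "\<phi> ` verts G \<subseteq> {1..l}" "edges G \<subseteq> col_edges r E \<phi> (verts G)"
proof -
  obtain \<phi> where "\<forall>v\<in>verts G. \<phi> v \<in> {1..l}" "\<forall>e\<in>edges G. image_mset \<phi> (mset_set e) \<in> E"
    using assms by (auto simp: Col_def colorable_def)
  thus thesis using assms by (intro that[of \<phi>]) (auto simp: Col_def col_edges_def rgraph_def)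
qed

section \<open>Boundedness and attainment of the extremal quantities of \<open>Col\<close>\<close>

lemma spec_radius_le_choose:
  assumes G: "rgraph r G" and "\<alpha> > 0" "verts G \<noteq> {}"
  shows "spec_radius r \<alpha> G \<le> fact r * real (card (verts G) choose r)"
proof -
  obtain x where x: "principal_eigenvector r \<alpha> G x"
    using exists_principal_eigenvector[OF G] assms by blast
  hence "\<bar>x v\<bar> \<le> 1" if "v \<in> verts G" for v
    using abs_le_1_if_lnorm_1[OF \<open>\<alpha> > 0\<close> _ _ that] G
    by (auto simp only: rgraph_def principal_eigenvector_def)
  hence "poly_form r G x \<le> fact r * real (num_edges G)"
    by (rule poly_form_le_num_edges[OF G])
  also have "\<dots> \<le> fact r * real (card (verts G) choose r)"
    using rgraph_num_edges_le[OF G] by (intro mult_left_mono) auto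
  finally show ?thesis using x by (simp add: principal_eigenvector_def)
qed

lemma spec_radius_le_fam:
  assumes "G \<in> Col r P" "card (verts G) = n" "n \<ge> 1" "\<alpha> > 0"
  shows "spec_radius r \<alpha> G \<le> spec_radius_fam r \<alpha> (Col r P) n"
  unfolding spec_radius_fam_def
proof (rule cSup_upper)
  show "bdd_above {spec_radius r \<alpha> G | G. G \<in> Col r P \<and> card (verts G) = n}"
  proof (rule bdd_aboveI)
    fix y assume "y \<in> {spec_radius r \<alpha> G | G. G \<in> Col r P \<and> card (verts G) = n}"
    then obtain H where H: "y = spec_radius r \<alpha> H" "H \<in> Col r P" "card (verts H) = n" by blast
    moreover from this have "verts H \<noteq> {}" using \<open>n \<ge> 1\<close> by auto
    ultimately show "y \<le> fact r * real (n choose r)"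
      using spec_radius_le_choose[OF Col_rgraph \<open>\<alpha> > 0\<close>, of H r P] by simp
  qed
qed (use assms in auto)

lemma finite_num_edges_Col: "finite {num_edges G | G. G \<in> Col r P \<and> card (verts G) = n}"
proof (rule finite_subset)
  show "{num_edges G | G. G \<in> Col r P \<and> card (verts G) = n} \<subseteq> {..n choose r}"
    using rgraph_num_edges_le[OF Col_rgraph] by fastforce
qed simp

lemma num_edges_le_ex_num:
  assumes "G \<in> Col r P" "card (verts G) = n"
  shows "num_edges G \<le> ex_num (Col r P) n"
  unfolding ex_num_def using assms by (intro Max_ge finite_num_edges_Col) auto

text \<open>Adding every edge that a given colouring permits stays inside \<open>Col\<close>, so
  some extremal graph is complete coloured. The monochromatic colouring shows that there is a graph
  to maximize over.\<close>

lemma ex_num_attained: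
  assumes "1 \<le> l"
  obtains \<phi> :: "nat \<Rightarrow> nat" and V where "finite V" "card V = n" "\<phi> ` V \<subseteq> {1..l}"
    "num_edges (col_graph r E \<phi> V) = ex_num (Col r (l, E)) n"
proof -
  let ?S = "{num_edges G | G. G \<in> Col r (l, E) \<and> card (verts G) = n}"
  have "(\<lambda>_. 1) ` {..<n} \<subseteq> {1..l}" using assms by auto
  hence "?S \<noteq> {}" using col_graph_in_Col[of "{..<n}" "\<lambda>_. 1" l r E] by force
  hence "ex_num (Col r (l, E)) n \<in> ?S"
    unfolding ex_num_def by (intro Max_in finite_num_edges_Col)
  then obtain G where G: "G \<in> Col r (l, E)" "card (verts G) = n"
    "num_edges G = ex_num (Col r (l, E)) n" by auto
  obtain \<phi> where \<phi>: "\<phi> ` verts G \<subseteq> {1..l}" "edges G \<subseteq> col_edges r E \<phi> (verts G)"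
    using Col_coloringE[OF G(1)] .
  have fin: "finite (verts G)" using G by (simp add: Col_def rgraph_def)
  have "num_edges G \<le> num_edges (col_graph r E \<phi> (verts G))"
    unfolding num_edges_def using \<phi>(2) rgraph_finite_edges[OF rgraph_col_graph[OF fin]]
    by (intro card_mono) auto
  moreover have "num_edges (col_graph r E \<phi> (verts G)) \<le> ex_num (Col r (l, E)) n"
    using num_edges_le_ex_num[OF col_graph_in_Col[OF fin \<phi>(1)]] G by simp
  ultimately show thesis using that[OF fin G(2) \<phi>(1)] G(3) by simp
qed

section \<open>The edge density\<close>

text \<open>The polynomial identity for an inserted vertex, evaluated at the all-ones
  vector.\<close>

lemma num_edges_col_graph_insert:
  assumes "finite V" "u \<notin> V"
  shows "num_edges (col_graph r E \<phi> (insert u V)) =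
    num_edges (col_graph r E \<phi> V) + card (col_link r E \<phi> (\<phi> u) V)"
proof -
  have "fact r * real (num_edges (col_graph r E \<phi> (insert u V))) =
      fact r * real (num_edges (col_graph r E \<phi> V) + card (col_link r E \<phi> (\<phi> u) V))"
    using poly_form_col_graph_insert[OF assms, of r E \<phi> "\<lambda>_. 1"]
    by (simp add: poly_form_one algebra_simps)
  thus ?thesis using of_nat_eq_iff by fastforce
qed

lemma vdegree_col_graph:
  assumes "finite V" "v \<in> V"
  shows "vdegree (col_graph r E \<phi> V) v = card (col_link r E \<phi> (\<phi> v) (V - {v}))"
  using sum_col_edges_containing[OF assms, of "\<lambda>_. 1::nat" r E \<phi>] by (simp add: vdegree_def)

text \<open>Clone a vertex whose degree is at least the average \<open>r * ex / n\<close>; the clone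
  inherits at least that many edges.\<close>

lemma ex_num_Suc_ge:
  assumes "1 \<le> l" "1 \<le> n"
  shows "real (ex_num (Col r (l, E)) n) * real (n + r) \<le> real (ex_num (Col r (l, E)) (Suc n)) * real n"
proof -
  obtain \<phi> :: "nat \<Rightarrow> nat" and V where V: "finite V" "card V = n" "\<phi> ` V \<subseteq> {1..l}"
    and ex: "num_edges (col_graph r E \<phi> V) = ex_num (Col r (l, E)) n"
    using ex_num_attained[OF assms(1)] by metis
  define ex0 where "ex0 = real (ex_num (Col r (l, E)) n)"
  let ?d = "\<lambda>v. real (vdegree (col_graph r E \<phi> V) v)"
  have "\<exists>v\<in>V. real r * ex0 \<le> real n * ?d v"
  proof (rule ccontr)
    assume "\<not> ?thesis"
    moreover have "V \<noteq> {}" using V assms by auto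
    ultimately have "(\<Sum>v\<in>V. real n * ?d v) < (\<Sum>v\<in>V. real r * ex0)"
      using V by (intro sum_strict_mono) auto
    also have "\<dots> = real n * (real r * ex0)" using V by simp
    also have "\<dots> = real n * (\<Sum>v\<in>V. ?d v)"
      using sum_vdegree[OF rgraph_col_graph[OF V(1), of r E \<phi>]] by (simp add: ex ex0_def)
    finally show False by (simp add: sum_distrib_left)
  qed
  then obtain v where v: "v \<in> V" "real r * ex0 \<le> real n * ?d v" by blast
  obtain u where u: "u \<notin> V" using V(1) ex_new_if_finite[OF infinite_UNIV_nat] by blast
  define \<psi> where "\<psi> = \<phi>(u := \<phi> v)"
  have cong: "col_edges r E \<psi> V = col_edges r E \<phi> V" "col_link r E \<psi> i V = col_link r E \<phi> i V" for i
    using V(1) u by (auto intro!: col_edges_cong col_link_cong simp: \<psi>_def)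
  have "\<psi> ` insert u V \<subseteq> {1..l}" using V v u by (auto simp: \<psi>_def)
  hence "col_graph r E \<psi> (insert u V) \<in> Col r (l, E)" using V by (intro col_graph_in_Col) auto
  hence "num_edges (col_graph r E \<psi> (insert u V)) \<le> ex_num (Col r (l, E)) (Suc n)"
    using V u by (intro num_edges_le_ex_num) auto
  moreover have "num_edges (col_graph r E \<psi> (insert u V)) =
      ex_num (Col r (l, E)) n + card (col_link r E \<phi> (\<phi> v) V)"
    using num_edges_col_graph_insert[OF V(1) u, of r E \<psi>] ex
    by (simp add: cong num_edges_def) (simp add: \<psi>_def)
  moreover have "vdegree (col_graph r E \<phi> V) v \<le> card (col_link r E \<phi> (\<phi> v) V)"
    unfolding vdegree_col_graph[OF V(1) v(1)]
    by (intro card_mono finite_col_link V col_link_mono) auto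
  ultimately have "ex0 + ?d v \<le> real (ex_num (Col r (l, E)) (Suc n))" by (simp add: ex0_def)
  hence "real n * (ex0 + ?d v) \<le> real n * real (ex_num (Col r (l, E)) (Suc n))"
    by (intro mult_left_mono) auto
  thus ?thesis using v(2) by (simp add: ex0_def algebra_simps)
qed

text \<open>Averaging over all vertex deletions from an extremal graph, as in the
  Katona-Nemetz-Simonovits argument. The factor uses real subtraction, so it is not truncated when
  \<open>r\<close> exceeds \<open>Suc n\<close>.\<close>

lemma ex_num_Suc_le:
  assumes "1 \<le> l"
  shows "real (ex_num (Col r (l, E)) (Suc n)) * (real (Suc n) - real r) \<le>
    real (Suc n) * real (ex_num (Col r (l, E)) n)"
proof -
  obtain \<phi> :: "nat \<Rightarrow> nat" and V where V: "finite V" "card V = Suc n" "\<phi> ` V \<subseteq> {1..l}"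
    and ex: "num_edges (col_graph r E \<phi> V) = ex_num (Col r (l, E)) (Suc n)"
    using ex_num_attained[OF assms(1)] by metis
  let ?d = "\<lambda>v. real (vdegree (col_graph r E \<phi> V) v)"
  have "real (ex_num (Col r (l, E)) (Suc n)) - ?d v \<le> real (ex_num (Col r (l, E)) n)" if v: "v \<in> V" for v
  proof -
    have "num_edges (col_graph r E \<phi> V) =
        num_edges (col_graph r E \<phi> (V - {v})) + vdegree (col_graph r E \<phi> V) v"
      using num_edges_col_graph_insert[of "V - {v}" v r E \<phi>] V v
      by (simp add: vdegree_col_graph insert_absorb)
    moreover have "num_edges (col_graph r E \<phi> (V - {v})) \<le> ex_num (Col r (l, E)) n"
      using V v by (intro num_edges_le_ex_num col_graph_in_Col) auto
    ultimately show ?thesis by (simp flip: ex)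
  qed
  hence "(\<Sum>v\<in>V. real (ex_num (Col r (l, E)) (Suc n)) - ?d v) \<le> (\<Sum>v\<in>V. real (ex_num (Col r (l, E)) n))"
    by (rule sum_mono)
  thus ?thesis
    using sum_vdegree[OF rgraph_col_graph[OF V(1), of r E \<phi>]] V
    by (simp add: sum_subtractf ex algebra_simps)
qed

text \<open>Colouring \<open>r\<close> vertices by a listing of some multiset of \<open>E\<close>
  makes the whole vertex set an edge.\<close>

lemma ex_num_pos_start:
  assumes "is_pattern r (l, E)" "E \<noteq> {}"
  shows "1 \<le> ex_num (Col r (l, E)) r"
proof -
  obtain m where m: "m \<in> E" "size m = r" "set_mset m \<subseteq> {1..l}"
    using assms by (auto simp: is_pattern_def)
  obtain xs where xs: "mset xs = m" using ex_mset by blast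
  have len: "length xs = r" using m xs by auto
  have "image_mset ((!) xs) (mset_set {..<r}) = mset (map ((!) xs) [0..<r])"
    by (simp add: atLeast0LessThan mset_map del: map_nth)
  also have "\<dots> = m" using xs len by (metis map_nth)
  finally have "{..<r} \<in> col_edges r E ((!) xs) {..<r}" using m by (simp add: col_edges_def)
  hence "1 \<le> num_edges (col_graph r E ((!) xs) {..<r})"
    using rgraph_finite_edges[OF rgraph_col_graph[of "{..<r}" r E "(!) xs"]]
    by (auto simp: num_edges_def Suc_le_eq card_gt_0_iff)
  also have "(!) xs ` {..<r} \<subseteq> {1..l}" using m xs len nth_mem by fastforce
  hence "num_edges (col_graph r E ((!) xs) {..<r}) \<le> ex_num (Col r (l, E)) r"
    by (intro num_edges_le_ex_num col_graph_in_Col) auto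
  finally show ?thesis .
qed

text \<open>Cloning multiplies \<open>ex_num\<close> by at least \<open>(n + r) / n\<close>, which
  is exactly the ratio of \<open>n + r choose r\<close> to \<open>n + r - 1 choose r\<close>. The
  constant is the value of this binomial at the starting point \<open>n = r\<close>.\<close>

lemma ex_num_lower_bound:
  assumes "is_pattern r (l, E)" "E \<noteq> {}" "1 \<le> r" "r \<le> n"
  shows "real (n + r - 1 choose r) \<le> real (2 * r - 1 choose r) * real (ex_num (Col r (l, E)) n)"
  using \<open>r \<le> n\<close>
proof (induction n rule: dec_induct)
  case base
  have "real (2 * r - 1 choose r) * 1 \<le> real (2 * r - 1 choose r) * real (ex_num (Col r (l, E)) r)"
    using ex_num_pos_start[OF assms(1,2)] by (intro mult_left_mono) auto
  thus ?case by (simp add: mult_2)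
next
  case (step n)
  let ?c = "real (2 * r - 1 choose r)" and ?ex = "\<lambda>n. real (ex_num (Col r (l, E)) n)"
  have n: "1 \<le> n" using assms step by simp
  have "n * (n + r choose r) = (n + r) * (n + r - 1 choose r)"
    using binomial_absorb_comp[of "n + r" r] by simp
  hence "real n * real (n + r choose r) = real (n + r) * real (n + r - 1 choose r)"
    by (metis of_nat_mult)
  also have "\<dots> \<le> real (n + r) * (?c * ?ex n)" using step by (intro mult_left_mono) auto
  also have "\<dots> = ?c * (?ex n * real (n + r))" by simp
  also have "\<dots> \<le> ?c * (?ex (Suc n) * real n)"
    using ex_num_Suc_ge[OF _ n, of l r E] assms by (intro mult_left_mono) (auto simp: is_pattern_def)
  finally have "real n * real (n + r choose r) \<le> real n * (?c * ?ex (Suc n))" by (simp add: mult_ac)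
  thus ?case using n by simp
qed

text \<open>\<open>lim\<close> is meaningful only after convergence is shown: the density is
  nonincreasing from \<open>n = r\<close> on and nonnegative. Its limit lies below every term and
  above \<open>1 / (2 * r - 1 choose r)\<close>. Positivity is later needed to divide by the density
  when choosing \<open>M\<close>.\<close>

lemma pi_hat_bounds:
  assumes "is_pattern r (l, E)" "E \<noteq> {}" "1 \<le> r"
  shows "0 < pi_hat r (Col r (l, E))"
    and "r \<le> n \<Longrightarrow> pi_hat r (Col r (l, E)) * real (n choose r) \<le> real (ex_num (Col r (l, E)) n)"
proof -
  define a where "a n = real (ex_num (Col r (l, E)) n) / real (n choose r)" for n
  have l: "1 \<le> l" using assms by (simp add: is_pattern_def)
  have "a (Suc n) \<le> a n" if "r \<le> n" for n
  proof -
    have b: "(real (Suc n) - real r) * real (Suc n choose r) = real (Suc n) * real (n choose r)"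
      using binomial_absorb_comp[of "Suc n" r] that
      by (metis diff_Suc_1 le_SucI of_nat_diff of_nat_mult)
    have pos: "0 < real (Suc n choose r)" "0 < real (n choose r)" using that by auto
    have "real (ex_num (Col r (l, E)) (Suc n)) * ((real (Suc n) - real r) * real (Suc n choose r)) \<le>
        real (Suc n) * real (ex_num (Col r (l, E)) n) * real (Suc n choose r)"
      using ex_num_Suc_le[OF l, of r E n] pos by (simp add: mult.assoc[symmetric] mult_right_mono)
    hence "real (Suc n) * (real (ex_num (Col r (l, E)) (Suc n)) * real (n choose r)) \<le>
        real (Suc n) * (real (ex_num (Col r (l, E)) n) * real (Suc n choose r))"
      unfolding b by (simp only: mult_ac)
    hence "real (ex_num (Col r (l, E)) (Suc n)) * real (n choose r) \<le>
        real (ex_num (Col r (l, E)) n) * real (Suc n choose r)" by simp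
    thus ?thesis using pos by (simp add: a_def frac_le_eq divide_le_eq le_divide_eq field_simps del: binomial_Suc_Suc)
  qed
  hence dec: "decseq (\<lambda>n. a (n + r))" by (intro decseq_SucI) simp
  moreover have "Bseq (\<lambda>n. a (n + r))"
  proof (rule decseq_bounded[OF dec])
    show "\<forall>n. 0 \<le> a (n + r)" by (simp add: a_def)
  qed
  ultimately obtain L where L: "(\<lambda>n. a (n + r)) \<longlonglongrightarrow> L"
    using Bseq_monoseq_convergent[of "\<lambda>n. a (n + r)"] by (auto simp: decseq_imp_monoseq convergent_def)
  hence "a \<longlonglongrightarrow> L" by (rule LIMSEQ_offset)
  hence pi: "pi_hat r (Col r (l, E)) = L"
    unfolding pi_hat_def a_def by (rule limI)
  show "0 < pi_hat r (Col r (l, E))"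
  proof -
    have c: "0 < real (2 * r - 1 choose r)" using assms by auto
    have "1 / real (2 * r - 1 choose r) \<le> a (n + r)" for n
    proof -
      have "real (n + r choose r) \<le> real (n + r + r - 1 choose r)"
        using assms by (intro of_nat_mono binomial_right_mono) simp_all
      also have "\<dots> \<le> real (2 * r - 1 choose r) * real (ex_num (Col r (l, E)) (n + r))"
        by (intro ex_num_lower_bound assms) simp
      finally show ?thesis using c by (simp add: a_def field_simps)
    qed
    hence "1 / real (2 * r - 1 choose r) \<le> L" by (intro LIMSEQ_le_const[OF L]) auto
    thus ?thesis using c pi by (simp add: less_le_trans[of 0 "1 / real (2 * r - 1 choose r)"])
  qed
  show "pi_hat r (Col r (l, E)) * real (n choose r) \<le> real (ex_num (Col r (l, E)) n)" if "r \<le> n"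
  proof -
    have "L \<le> a (n - r + r)" by (rule decseq_ge[OF dec L])
    thus ?thesis using that by (simp add: a_def pi pos_le_divide_eq)
  qed
qed

section \<open>Lower bound on the entries of an eigenvector\<close>

definition spec_extremal ::
    "nat \<Rightarrow> real \<Rightarrow> nat hypergraph set \<Rightarrow> nat \<Rightarrow> nat hypergraph \<Rightarrow> bool" where
  "spec_extremal r \<alpha> F n G \<longleftrightarrow>
     G \<in> F \<and> card (verts G) = n \<and> spec_radius r \<alpha> G = spec_radius_fam r \<alpha> F n"

lemma ex_num_le_spec_radius_fam:
  assumes "1 \<le> l" "1 \<le> r" "1 \<le> n" "0 < \<alpha>"
  shows "fact r * real (ex_num (Col r (l, E)) n) \<le>
    spec_radius_fam r \<alpha> (Col r (l, E)) n * real n powr (r / \<alpha>)"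
proof -
  obtain \<phi> :: "nat \<Rightarrow> nat" and V where V: "finite V" "card V = n" "\<phi> ` V \<subseteq> {1..l}"
    and ex: "num_edges (col_graph r E \<phi> V) = ex_num (Col r (l, E)) n"
    using ex_num_attained[OF assms(1)] by metis
  have "fact r * real (ex_num (Col r (l, E)) n) \<le>
      spec_radius r \<alpha> (col_graph r E \<phi> V) * real n powr (r / \<alpha>)"
    using num_edges_le_spec_radius[OF rgraph_col_graph[OF V(1)] assms(4,2), of E \<phi>] ex V by simp
  also have "\<dots> \<le> spec_radius_fam r \<alpha> (Col r (l, E)) n * real n powr (r / \<alpha>)"
    using spec_radius_le_fam[OF col_graph_in_Col[OF V(1,3)]] V assms
    by (intro mult_right_mono) auto
  finally show ?thesis .
qed

lemma spec_radius_fam_pos: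
  assumes "is_pattern r (l, E)" "E \<noteq> {}" "1 \<le> r" "r \<le> n" "0 < \<alpha>"
  shows "0 < spec_radius_fam r \<alpha> (Col r (l, E)) n"
proof -
  have "0 < real (n choose r)" using assms by simp
  hence "0 < pi_hat r (Col r (l, E)) * real (n choose r)"
    using pi_hat_bounds(1)[OF assms(1-3)] by simp
  also have "\<dots> \<le> real (ex_num (Col r (l, E)) n)" by (rule pi_hat_bounds(2)[OF assms(1-4)])
  finally have "0 < fact r * real (ex_num (Col r (l, E)) n)" by simp
  also have "\<dots> \<le> spec_radius_fam r \<alpha> (Col r (l, E)) n * real n powr (r / \<alpha>)"
    using assms by (intro ex_num_le_spec_radius_fam) (auto simp: is_pattern_def)
  finally show ?thesis by (simp add: zero_less_mult_iff)
qed

text \<open>Extremality bounds the radius of the completion by that of \<open>G\<close>, so the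
  given eigenvector survives. In the completed graph a link depends on the colour of a vertex, which
  is what cloning exploits.\<close>

lemma spec_extremal_completion:
  assumes G: "spec_extremal r \<alpha> (Col r (l, E)) n G" and "1 \<le> n" "0 < \<alpha>"
    and x: "principal_eigenvector r \<alpha> G x"
  obtains \<phi> where "\<phi> ` verts G \<subseteq> {1..l}"
    "principal_eigenvector r \<alpha> (col_graph r E \<phi> (verts G)) x"
    "spec_radius r \<alpha> (col_graph r E \<phi> (verts G)) = spec_radius_fam r \<alpha> (Col r (l, E)) n"
proof -
  have GC: "G \<in> Col r (l, E)" and card: "card (verts G) = n"
    and lam: "spec_radius r \<alpha> G = spec_radius_fam r \<alpha> (Col r (l, E)) n"
    using G by (auto simp: spec_extremal_def)
  have rG: "rgraph r G" using Col_rgraph[OF GC] .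
  hence fin: "finite (verts G)" by (simp add: rgraph_def)
  obtain \<phi> where \<phi>: "\<phi> ` verts G \<subseteq> {1..l}" "edges G \<subseteq> col_edges r E \<phi> (verts G)"
    using Col_coloringE[OF GC] .
  let ?K = "col_graph r E \<phi> (verts G)"
  have "spec_radius r \<alpha> ?K \<le> spec_radius r \<alpha> G"
    unfolding lam using card assms by (intro spec_radius_le_fam col_graph_in_Col fin \<phi>) auto
  hence "principal_eigenvector r \<alpha> ?K x" "spec_radius r \<alpha> ?K = spec_radius r \<alpha> G"
    using principal_eigenvector_supergraph[OF rG rgraph_col_graph[OF fin], of E \<phi> \<alpha> x] \<phi> assms by auto
  thus thesis using that \<phi> lam by simp
qed

text \<open>A vertex of maximum weight is cloned, but the clone gets weight \<open>n\<^sup>-\<^sup>1\<^sup>/\<^sup>\<alpha>\<close>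
  instead of the weight of the original vertex, which makes the bound independent of the eigenvector.\<close>

lemma spec_radius_fam_Suc_ge:
  assumes G: "spec_extremal r \<alpha> (Col r (l, E)) n G" and "1 \<le> n" "1 < \<alpha>" "1 \<le> r"
  shows "spec_radius_fam r \<alpha> (Col r (l, E)) n * (1 + real r / real n) \<le>
    spec_radius_fam r \<alpha> (Col r (l, E)) (Suc n) * (1 + 1 / real n) powr (r / \<alpha>)"
proof -
  define V \<Lambda> where "V = verts G" and "\<Lambda> = spec_radius_fam r \<alpha> (Col r (l, E)) n"
  have a0: "0 < \<alpha>" using assms by simp
  have card: "card V = n" and fin: "finite V"
    using G by (auto simp: V_def spec_extremal_def Col_def rgraph_def)
  hence ne: "V \<noteq> {}" using assms by auto
  obtain x where xG: "principal_eigenvector r \<alpha> G x"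
    using exists_principal_eigenvector[of r G \<alpha>] G ne a0 Col_rgraph
    by (auto simp: spec_extremal_def V_def)
  obtain \<phi> where \<phi>: "\<phi> ` V \<subseteq> {1..l}"
    and x: "principal_eigenvector r \<alpha> (col_graph r E \<phi> V) x"
    and lam: "spec_radius r \<alpha> (col_graph r E \<phi> V) = \<Lambda>"
    using spec_extremal_completion[OF G assms(2) a0 xG] unfolding V_def \<Lambda>_def by blast
  note px = principal_eigenvectorD[OF x a0, simplified]
  have L0: "0 \<le> \<Lambda>" using poly_form_nonneg[OF rgraph_col_graph[OF fin]] px lam by (metis verts_col_graph)
  have "\<exists>v\<in>V. 1 / real n \<le> x v powr \<alpha>"
  proof (rule ccontr)
    assume "\<not> ?thesis"
    hence "(\<Sum>v\<in>V. x v powr \<alpha>) < (\<Sum>v\<in>V. 1 / real n)"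
      using fin ne by (intro sum_strict_mono) auto
    thus False using px(2) card assms by simp
  qed
  then obtain v where v: "v \<in> V" "1 / real n \<le> x v powr \<alpha>" by blast
  define \<theta> where "\<theta> = (1 / real n) powr (1 / \<alpha>)"
  have n0: "0 < 1 / real n" using assms by simp
  have \<theta>: "0 < \<theta>" "\<theta> powr \<alpha> = 1 / real n" using n0 a0 by (simp_all add: \<theta>_def powr_powr)
  have "\<theta> \<le> (x v powr \<alpha>) powr (1 / \<alpha>)"
    unfolding \<theta>_def using v a0 by (intro powr_mono2) auto
  also have "\<dots> = x v" using a0 px(1)[OF v(1)] by (simp add: powr_powr)
  finally have \<theta>x: "\<theta> \<le> x v" .
  obtain u where u: "u \<notin> V" using fin ex_new_if_finite[OF infinite_UNIV_nat] by blast
  define \<psi> y where "\<psi> = \<phi>(u := \<phi> v)" and "y = x(u := \<theta>)"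
  have cong: "col_edges r E \<psi> V = col_edges r E \<phi> V" "col_link r E \<psi> i V = col_link r E \<phi> i V" for i
    using fin u by (auto intro!: col_edges_cong col_link_cong simp: \<psi>_def)
  have y0: "0 \<le> y w" if "w \<in> insert u V" for w using that px(1) \<theta> by (auto simp: y_def)
  let ?H = "col_graph r E \<psi> (insert u V)"
  have rH: "rgraph r ?H" using fin by (intro rgraph_col_graph) auto
  have linkeq: "(\<Sum>f\<in>col_link r E \<phi> i V. \<Prod>w\<in>f. y w) = (\<Sum>f\<in>col_link r E \<phi> i V. \<Prod>w\<in>f. x w)" for i
    using u by (intro sum.cong prod.cong) (auto simp: y_def col_link_def)
  have Pxy: "poly_form r (col_graph r E \<psi> V) y = \<Lambda>"
  proof -
    have "poly_form r (col_graph r E \<psi> V) y = poly_form r (col_graph r E \<phi> V) x"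
      unfolding poly_form_def edges_col_graph cong using u
      by (intro arg_cong[where f = "(*) _"] sum.cong prod.cong) (auto simp: y_def col_edges_def)
    thus ?thesis using px lam by simp
  qed
  \<comment> \<open>Since \<open>\<alpha> > 1\<close>, replacing \<open>x v\<close> by the smaller
    \<open>\<theta>\<close> only lowers the right side of the eigenvalue equation at
    \<open>v\<close>. The last step of the chain enlarges the link: the clone may also share edges
    with \<open>v\<close>, and these contribute nonnegatively.\<close>
  have "real r * \<Lambda> * \<theta> powr (\<alpha> - 1) \<le> real r * \<Lambda> * x v powr (\<alpha> - 1)"
    using \<theta> \<theta>x L0 assms by (intro mult_left_mono powr_mono2) auto
  also have "\<dots> = poly_deriv r (col_graph r E \<phi> V) v x"
    using eigen_equation[OF rgraph_col_graph[OF fin] x a0 assms(4), of v] v \<theta> \<theta>x lam by simp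
  also have "\<dots> \<le> fact r * (\<Sum>f\<in>col_link r E \<phi> (\<phi> v) V. \<Prod>w\<in>f. x w)"
    unfolding poly_deriv_col_graph[OF fin v(1)]
    using px(1) by (intro mult_left_mono sum_col_link_Diff_le fin) auto
  finally have "\<theta> * (real r * \<Lambda> * \<theta> powr (\<alpha> - 1)) \<le>
      \<theta> * (fact r * (\<Sum>f\<in>col_link r E \<phi> (\<phi> v) V. \<Prod>w\<in>f. x w))"
    using \<theta> by (intro mult_left_mono) auto
  moreover have "\<theta> * (real r * \<Lambda> * \<theta> powr (\<alpha> - 1)) = real r * \<Lambda> * \<theta> powr \<alpha>"
    using \<theta> by (simp add: powr_diff)
  moreover have "poly_form r ?H y =
      \<Lambda> + \<theta> * (fact r * (\<Sum>f\<in>col_link r E \<phi> (\<phi> v) V. \<Prod>w\<in>f. x w))"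
    unfolding poly_form_col_graph_insert[OF fin u] Pxy cong linkeq[symmetric]
    by (simp add: y_def \<psi>_def)
  moreover have "\<Lambda> * (1 + real r / real n) = \<Lambda> + real r * \<Lambda> * \<theta> powr \<alpha>"
    using \<theta> by (simp add: algebra_simps)
  ultimately have "\<Lambda> * (1 + real r / real n) \<le> poly_form r ?H y" by linarith
  also have "\<dots> \<le> spec_radius r \<alpha> ?H * (\<Sum>w\<in>insert u V. \<bar>y w\<bar> powr \<alpha>) powr (r / \<alpha>)"
    using poly_form_le_homogeneous[OF rH a0 assms(4), of y] by simp
  also have "(\<Sum>w\<in>insert u V. \<bar>y w\<bar> powr \<alpha>) = (\<Sum>w\<in>insert u V. y w powr \<alpha>)"
    using y0 by (intro sum.cong) auto
  also have "\<dots> = 1 / real n + (\<Sum>w\<in>V. y w powr \<alpha>)" using fin u \<theta> by (simp add: y_def)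
  also have "(\<Sum>w\<in>V. y w powr \<alpha>) = (\<Sum>w\<in>V. x w powr \<alpha>)"
    using u by (intro sum.cong) (auto simp: y_def)
  also have "\<dots> = 1" using px by simp
  also have "spec_radius r \<alpha> ?H * (1 / real n + 1) powr (r / \<alpha>) \<le>
      spec_radius_fam r \<alpha> (Col r (l, E)) (Suc n) * (1 / real n + 1) powr (r / \<alpha>)"
  proof (intro mult_right_mono spec_radius_le_fam col_graph_in_Col)
    show "\<psi> ` insert u V \<subseteq> {1..l}" using \<phi> v u by (auto simp: \<psi>_def)
  qed (use fin u card a0 in auto)
  finally show ?thesis by (simp add: \<Lambda>_def add.commute)
qed

text \<open>Deleting \<open>v\<close> costs \<open>x v\<close> times the partial derivative at
  \<open>v\<close>, which the eigenvalue equation evaluates to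
  \<open>r * \<Lambda> * x v powr \<alpha>\<close>. For \<open>x v = 0\<close> both quantities
  vanish, so positivity of the entries, which is to be derived from this bound, is not
  presupposed.\<close>

lemma spec_radius_fam_remove_vertex:
  assumes G: "spec_extremal r \<alpha> (Col r (l, E)) (Suc n) G" and "1 \<le> n" "1 < \<alpha>" "1 \<le> r"
    and xG: "principal_eigenvector r \<alpha> G x" and v: "v \<in> verts G"
  shows "spec_radius_fam r \<alpha> (Col r (l, E)) (Suc n) * (1 - real r * x v powr \<alpha>) \<le>
    spec_radius_fam r \<alpha> (Col r (l, E)) n * (1 - x v powr \<alpha>) powr (r / \<alpha>)"
proof -
  define V \<Lambda> where "V = verts G" and "\<Lambda> = spec_radius_fam r \<alpha> (Col r (l, E)) (Suc n)"
  have a0: "0 < \<alpha>" using assms by simp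
  have card: "card V = Suc n" and fin: "finite V" and v: "v \<in> V"
    using G v by (auto simp: V_def spec_extremal_def Col_def rgraph_def)
  obtain \<phi> where \<phi>: "\<phi> ` V \<subseteq> {1..l}"
    and x: "principal_eigenvector r \<alpha> (col_graph r E \<phi> V) x"
    and lam: "spec_radius r \<alpha> (col_graph r E \<phi> V) = \<Lambda>"
    using spec_extremal_completion[OF G _ a0 xG] unfolding V_def \<Lambda>_def by auto
  note px = principal_eigenvectorD[OF x a0, simplified]
  have "x v * poly_deriv r (col_graph r E \<phi> V) v x = real r * \<Lambda> * x v powr \<alpha>"
  proof (cases "x v = 0")
    case False
    thus ?thesis using eigen_equation[OF rgraph_col_graph[OF fin] x a0 assms(4), of v] v px(1)[OF v] lam
      by (simp add: powr_diff)
  qed simp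
  hence "\<Lambda> * (1 - real r * x v powr \<alpha>) = poly_form r (col_graph r E \<phi> (V - {v})) x"
    using poly_form_col_graph_remove[OF fin v, of r E \<phi> x] px(3) lam by (simp add: algebra_simps)
  also have "\<dots> \<le> spec_radius r \<alpha> (col_graph r E \<phi> (V - {v})) *
      (\<Sum>w\<in>V - {v}. \<bar>x w\<bar> powr \<alpha>) powr (r / \<alpha>)"
    using poly_form_le_homogeneous[OF rgraph_col_graph a0 assms(4), of "V - {v}" E \<phi> x] fin by simp
  also have "(\<Sum>w\<in>V - {v}. \<bar>x w\<bar> powr \<alpha>) = (\<Sum>w\<in>V - {v}. x w powr \<alpha>)"
    using px(1) by (intro sum.cong) auto
  also have "\<dots> = 1 - x v powr \<alpha>" using px(2) fin v by (simp add: sum_diff1)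
  also have "spec_radius r \<alpha> (col_graph r E \<phi> (V - {v})) * (1 - x v powr \<alpha>) powr (r / \<alpha>) \<le>
      spec_radius_fam r \<alpha> (Col r (l, E)) n * (1 - x v powr \<alpha>) powr (r / \<alpha>)"
  proof (intro mult_right_mono spec_radius_le_fam col_graph_in_Col)
    show "\<phi> ` (V - {v}) \<subseteq> {1..l}" using \<phi> by auto
  qed (use fin v card a0 assms in auto)
  finally show ?thesis by (simp add: \<Lambda>_def)
qed

text \<open>In terms of the deficit \<open>d\<close> the base on the right is exactly
  \<open>1 + d * N / K\<close>. Bounding the power by an exponential and then by its quadratic
  estimate makes the inequality linear in \<open>d\<close> up to errors of order
  \<open>1 / (N * K)\<close>, and \<open>r - \<beta> > 0\<close> is the net slope.\<close>

lemma weight_gap_bound: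
  fixes N r \<beta> t :: real
  assumes N: "r + 1 \<le> N" and r: "1 \<le> r" and \<beta>: "0 < \<beta>" "\<beta> < r" and t: "0 \<le> t" "t \<le> 1 / N"
    and ineq: "(1 - r * t) * (1 + r / (N - 1)) \<le> ((1 + 1 / (N - 1)) * (1 - t)) powr \<beta>"
  shows "1 / N - 2 * (3 * r\<^sup>2 + r) / (r - \<beta>) / N\<^sup>2 \<le> t"
proof -
  define K d y where "K = N - 1" and "d = 1 / N - t" and "y = d * N / K"
  have pos: "0 < K" "0 < N" "r \<le> K" "N \<le> 2 * K" using N r by (auto simp: K_def)
  have NK: "N = K + 1" by (simp add: K_def)
  have d: "0 \<le> d" "d \<le> 1 / N" using t by (auto simp: d_def)
  have y: "0 \<le> y" using d pos by (simp add: y_def)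
  have yK: "y \<le> 1 / K" using d pos by (simp add: y_def field_simps)
  have "(1 + 1 / K) * (1 - t) = 1 + y"
  proof -
    have "d * N = 1 - t * (K + 1)" using pos by (simp add: d_def NK left_diff_distrib)
    thus ?thesis using pos by (simp add: y_def field_simps)
  qed
  moreover have "(1 + y) powr \<beta> \<le> exp (\<beta> * y)"
  proof -
    have "(1 + y) powr \<beta> \<le> exp y powr \<beta>" using y \<beta> by (intro powr_mono2) auto
    thus ?thesis by (simp add: powr_def mult_ac)
  qed
  moreover have by1: "\<beta> * y \<le> \<beta> / K" using mult_left_mono[OF yK, of \<beta>] \<beta> by simp
  moreover have "\<beta> / K \<le> 1" using \<beta> pos by simp
  hence "exp (\<beta> * y) \<le> 1 + \<beta> * y + (\<beta> * y)\<^sup>2" using by1 y \<beta> by (intro exp_bound) auto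
  moreover have "(\<beta> * y)\<^sup>2 \<le> (\<beta> / K)\<^sup>2" using by1 y \<beta> by (intro power_mono) auto
  ultimately have 1: "(1 - r * t) * (1 + r / K) \<le> 1 + \<beta> * y + (\<beta> / K)\<^sup>2"
    using ineq by (simp add: K_def[symmetric])
  have "(1 - r * t) * (1 + r / K) = 1 + (r - r\<^sup>2) / (N * K) + r * d + r\<^sup>2 * d / K"
  proof -
    define p q where "p = 1 / K" and "q = 1 / N"
    have "p - q = q * p" using pos by (simp add: p_def q_def NK field_simps)
    moreover have "t = q - d" by (simp add: d_def q_def)
    ultimately have "(1 - r * t) * (1 + r * p) = 1 + (r - r\<^sup>2) * (q * p) + r * d + r\<^sup>2 * d * p"
      by algebra
    thus ?thesis by (simp add: p_def q_def)
  qed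
  moreover have "0 \<le> r\<^sup>2 * d / K" "- r\<^sup>2 / (N * K) \<le> (r - r\<^sup>2) / (N * K)"
    using d pos r divide_right_mono[of "- r\<^sup>2" "r - r\<^sup>2" "N * K"] by auto
  ultimately have 2: "1 - r\<^sup>2 / (N * K) + r * d \<le> (1 - r * t) * (1 + r / K)" by simp
  have "\<beta> * y = \<beta> * d + \<beta> * d / K" using pos unfolding y_def NK by (simp add: field_simps)
  also have "\<beta> * d / K \<le> r * (1 / N) / K"
    using pos d \<beta> by (intro divide_right_mono mult_mono) auto
  finally have 3: "\<beta> * y \<le> \<beta> * d + r / (N * K)" by simp
  have "(\<beta> / K)\<^sup>2 \<le> (r / K)\<^sup>2" using \<beta> pos by (intro power_mono divide_right_mono) auto
  also have "\<dots> = r\<^sup>2 / (K * K)" by (simp add: power2_eq_square)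
  also have "\<dots> = 2 * r\<^sup>2 / (2 * K * K)" by simp
  also have "\<dots> \<le> 2 * r\<^sup>2 / (N * K)" using pos by (intro divide_left_mono mult_right_mono) auto
  finally have 4: "(\<beta> / K)\<^sup>2 \<le> 2 * r\<^sup>2 / (N * K)" .
  \<comment> \<open>The terms \<open>r\<^sup>2\<close>, \<open>r\<close> and
    \<open>2 * r\<^sup>2\<close> come from the expansion of the left side, from the excess
    \<open>y - d = d / K\<close>, and from the square in the exponential estimate. The further
    factor 2 comes from \<open>N \<le> 2 * K\<close>.\<close>
  have "(r - \<beta>) * d \<le> r\<^sup>2 / (N * K) + r / (N * K) + 2 * r\<^sup>2 / (N * K)"
    using 1 2 3 4 by (simp add: algebra_simps)
  also have "\<dots> = 2 * (3 * r\<^sup>2 + r) / (2 * K * N)" by (simp add: add_divide_distrib mult_ac)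
  also have "\<dots> \<le> 2 * (3 * r\<^sup>2 + r) / (N * N)"
    using pos r by (intro divide_left_mono mult_right_mono) auto
  finally have "d \<le> 2 * (3 * r\<^sup>2 + r) / (N * N) / (r - \<beta>)" using \<beta> by (subst pos_le_divide_eq) (auto simp: mult.commute)
  thus ?thesis by (simp add: d_def power2_eq_square mult_ac)
qed

definition gap_const :: "nat \<Rightarrow> real \<Rightarrow> real" where
  "gap_const r \<alpha> = 2 * (3 * (real r)\<^sup>2 + real r) / (real r - real r / \<alpha>)"

text \<open>Multiplying the deletion bound by \<open>1 + r / (n - 1)\<close> allows the cloning
  bound from \<open>n - 1\<close> to \<open>n\<close> to be inserted, after which the radius on
  \<open>n\<close> vertices cancels. Only entries with \<open>x v powr \<alpha> \<le> 1 / n\<close>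
  need this.\<close>

lemma principal_eigenvector_entry_ge:
  assumes pat: "is_pattern r (l, E)" "E \<noteq> {}" "1 \<le> r" and "1 < \<alpha>" and n: "r < n"
    and H: "spec_extremal r \<alpha> (Col r (l, E)) (n - 1) H"
    and G: "spec_extremal r \<alpha> (Col r (l, E)) n G"
    and x: "principal_eigenvector r \<alpha> G x" and v: "v \<in> verts G"
  shows "1 / real n - gap_const r \<alpha> / (real n)\<^sup>2 \<le> x v powr \<alpha>"
proof (cases "x v powr \<alpha> \<le> 1 / real n")
  case False
  have "0 < real r - real r / \<alpha>" using assms by (simp add: field_simps)
  hence "0 \<le> gap_const r \<alpha> / (real n)\<^sup>2"
    unfolding gap_const_def by (intro divide_nonneg_nonneg mult_nonneg_nonneg add_nonneg_nonneg) auto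
  thus ?thesis using False by simp
next
  case True
  define \<beta> N where "\<beta> = real r / \<alpha>" and "N = real n"
  define \<Lambda> where "\<Lambda> n = spec_radius_fam r \<alpha> (Col r (l, E)) n" for n
  define t where "t = x v powr \<alpha>"
  have n1: "1 \<le> n - 1" and Suc: "Suc (n - 1) = n" using n pat by auto
  have K: "real (n - 1) = N - 1" using n by (simp add: N_def of_nat_diff)
  have N: "real r + 1 \<le> N" using n by (simp add: N_def)
  have a: "\<Lambda> (n - 1) * (1 + real r / (N - 1)) \<le> \<Lambda> n * (1 + 1 / (N - 1)) powr \<beta>"
    using spec_radius_fam_Suc_ge[OF H n1 \<open>1 < \<alpha>\<close> pat(3)] unfolding Suc K \<Lambda>_def \<beta>_def .
  have b: "\<Lambda> n * (1 - real r * t) \<le> \<Lambda> (n - 1) * (1 - t) powr \<beta>"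
    using spec_radius_fam_remove_vertex[OF _ n1 \<open>1 < \<alpha>\<close> pat(3) x v] G
    unfolding Suc t_def \<Lambda>_def \<beta>_def by blast
  have L: "0 < \<Lambda> n" unfolding \<Lambda>_def using assms by (intro spec_radius_fam_pos) auto
  have "1 / N \<le> 1" using N by simp
  hence t1: "t \<le> 1" using True by (simp add: t_def N_def)
  have "\<Lambda> n * (1 - real r * t) * (1 + real r / (N - 1)) \<le> \<Lambda> (n - 1) * (1 - t) powr \<beta> * (1 + real r / (N - 1))"
    using b N pat by (intro mult_right_mono) (auto intro!: add_nonneg_nonneg)
  also have "\<dots> = (\<Lambda> (n - 1) * (1 + real r / (N - 1))) * (1 - t) powr \<beta>" by simp
  also have "\<dots> \<le> (\<Lambda> n * (1 + 1 / (N - 1)) powr \<beta>) * (1 - t) powr \<beta>"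
    using a by (intro mult_right_mono) auto
  also have "\<dots> = \<Lambda> n * ((1 + 1 / (N - 1)) * (1 - t)) powr \<beta>"
    using N pat t1 by (subst powr_mult) auto
  finally have "(1 - real r * t) * (1 + real r / (N - 1)) \<le> ((1 + 1 / (N - 1)) * (1 - t)) powr \<beta>"
    using L by (simp add: mult.assoc)
  hence "1 / N - 2 * (3 * (real r)\<^sup>2 + real r) / (real r - \<beta>) / N\<^sup>2 \<le> t"
    using N pat assms True
    by (intro weight_gap_bound) (auto simp: \<beta>_def t_def N_def divide_less_eq)
  thus ?thesis by (simp add: gap_const_def N_def t_def \<beta>_def)
qed

section \<open>Growth of the spectral radius\<close>

text \<open>Swapping \<open>u\<close> and \<open>v\<close> preserves colours and sends the link of
  \<open>u\<close> into the link of \<open>v\<close>. A link set containing \<open>v\<close> then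
  contains the heavier \<open>u\<close> instead, so the lighter vertex has the larger
  derivative.\<close>

lemma poly_deriv_same_color_le:
  assumes "finite V" and u: "u \<in> V" and v: "v \<in> V" and "\<phi> u = \<phi> v" "u \<noteq> v" "x v \<le> x u"
    and x0: "\<And>w. w \<in> V \<Longrightarrow> 0 \<le> x w"
  shows "poly_deriv r (col_graph r E \<phi> V) u x \<le> poly_deriv r (col_graph r E \<phi> V) v x"
proof -
  define \<tau> where "\<tau> = Transposition.transpose u v"
  define Lu Lv where "Lu = col_link r E \<phi> (\<phi> u) (V - {u})" and "Lv = col_link r E \<phi> (\<phi> v) (V - {v})"
  have inj: "inj_on \<tau> f" for f unfolding \<tau>_def by (rule inj_on_transpose)
  have sub: "(`) \<tau> ` Lu \<subseteq> Lv"
  proof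
    fix g assume "g \<in> (`) \<tau> ` Lu"
    then obtain f where f: "f \<in> Lu" "g = \<tau> ` f" by blast
    have "image_mset \<phi> (mset_set g) = image_mset (\<phi> \<circ> \<tau>) (mset_set f)"
      using image_mset_mset_set[OF inj, of f] f by (simp flip: image_mset.compositionality)
    also have "\<phi> \<circ> \<tau> = \<phi>" using assms by (auto simp: \<tau>_def Transposition.transpose_def)
    finally have "image_mset \<phi> (mset_set g) = image_mset \<phi> (mset_set f)" .
    moreover have "card g = card f" using f inj by (simp add: card_image)
    moreover have "g \<subseteq> V - {v}" using f u v by (auto simp: Lu_def col_link_def \<tau>_def Transposition.transpose_def)
    ultimately show "g \<in> Lv" using f assms by (simp add: Lu_def Lv_def col_link_def)
  qed
  have "(\<Sum>f\<in>Lu. \<Prod>w\<in>f. x w) \<le> (\<Sum>f\<in>Lu. \<Prod>w\<in>\<tau> ` f. x w)"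
  proof (rule sum_mono)
    fix f assume "f \<in> Lu"
    hence "f \<subseteq> V - {u}" by (simp add: Lu_def col_link_def)
    hence "(\<Prod>w\<in>f. x w) \<le> (\<Prod>w\<in>f. x (\<tau> w))"
      using assms by (intro prod_mono) (auto simp: \<tau>_def Transposition.transpose_def)
    thus "(\<Prod>w\<in>f. x w) \<le> (\<Prod>w\<in>\<tau> ` f. x w)" by (simp add: prod.reindex[OF inj])
  qed
  also have "\<dots> = (\<Sum>g\<in>(`) \<tau> ` Lu. \<Prod>w\<in>g. x w)"
  proof -
    have "inj_on ((`) \<tau>) Lu" using inj_image_eq_iff[OF inj] by (auto intro!: inj_onI)
    thus ?thesis by (simp add: sum.reindex)
  qed
  also have "\<dots> \<le> (\<Sum>g\<in>Lv. \<Prod>w\<in>g. x w)"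
    using sub assms(1) x0 by (intro sum_mono2 prod_nonneg)
      (auto simp: Lv_def finite_col_link, auto simp: col_link_def)
  finally show ?thesis using assms by (simp add: poly_deriv_col_graph Lu_def Lv_def)
qed

text \<open>By the eigenvalue equation and \<open>\<alpha> > 1\<close> a heavier vertex has the
  strictly larger derivative, whereas the swap of two vertices of one colour shows the opposite weak
  inequality.\<close>

lemma principal_eigenvector_same_color:
  assumes "finite V" and x: "principal_eigenvector r \<alpha> (col_graph r E \<phi> V) x"
    and "0 < spec_radius r \<alpha> (col_graph r E \<phi> V)" "1 < \<alpha>" "1 \<le> r"
    and pos: "\<And>w. w \<in> V \<Longrightarrow> 0 < x w" and "u \<in> V" "v \<in> V" "\<phi> u = \<phi> v"
  shows "x u = x v"
proof -
  have "x u \<le> x v" if uv: "u \<in> V" "v \<in> V" "\<phi> u = \<phi> v" for u v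
  proof (rule ccontr)
    assume "\<not> x u \<le> x v"
    hence less: "x v < x u" by simp
    have eq: "poly_deriv r (col_graph r E \<phi> V) w x =
        real r * spec_radius r \<alpha> (col_graph r E \<phi> V) * x w powr (\<alpha> - 1)" if "w \<in> V" for w
      using eigen_equation[OF rgraph_col_graph[OF assms(1)] x] assms(3-5) pos that by simp
    have "poly_deriv r (col_graph r E \<phi> V) u x \<le> poly_deriv r (col_graph r E \<phi> V) v x"
      using less pos uv assms(1) less_imp_le by (intro poly_deriv_same_color_le) auto
    moreover have "x v powr (\<alpha> - 1) < x u powr (\<alpha> - 1)"
      using less pos[OF uv(2)] assms by (intro powr_less_mono2) auto
    ultimately show False using assms(3,5) uv by (simp add: eq)
  qed
  thus ?thesis using assms by (simp add: order_antisym)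
qed

text \<open>Here \<open>c = 1 / \<alpha>\<close>, \<open>X\<close> is the relative gain from a
  clone, and \<open>1 - c * p\<close> accounts for its cost in the norm. The claim is the convex
  combination, with weights \<open>1 - c\<close> and \<open>c\<close>, of consequences of the two
  bounds on \<open>X\<close>.\<close>

lemma clone_gain_arith:
  fixes s r p m X c :: real
  assumes "0 \<le> m" "m \<le> r" "r < s" and p: "p = m / s" and c: "0 \<le> c" "c \<le> 1"
    and X: "m \<le> s * X" "m \<le> (s + 1 - m) * X"
  shows "1 + p * (1 - c - c / (s - r + 1)) \<le> (1 + X) * (1 - c * p)"
proof -
  define q where "q = s - r + 1"
  have pos: "0 < s" "0 < q" "0 < s + 1 - m" "1 \<le> q" using assms by (auto simp: q_def)
  have p1: "0 \<le> p" "p \<le> 1" using assms pos by (auto simp: divide_le_eq)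
  have 0: "0 \<le> X - p" using X(1) pos by (simp add: p field_simps)
  have "1 / (s + 1 - m) \<le> 1 / q" using assms pos by (intro divide_left_mono) (auto simp: q_def)
  hence "p * (1 - 1 / q) \<le> p * (1 - 1 / (s + 1 - m))" using p1 by (intro mult_left_mono) auto
  also have "\<dots> = m / (s + 1 - m) * (1 - p)" using pos by (simp add: p field_simps)
  also have "\<dots> \<le> X * (1 - p)" using X(2) pos p1 by (intro mult_right_mono) (auto simp: divide_le_eq mult.commute)
  finally have 1: "0 \<le> X * (1 - p) - p * (1 - 1 / q)" by simp
  have "0 \<le> (1 - c) * (X - p) + c * (X * (1 - p) - p * (1 - 1 / q))"
    using 0 1 c by (intro add_nonneg_nonneg mult_nonneg_nonneg) auto
  also have "\<dots> = (1 + X) * (1 - c * p) - (1 + p * (1 - c - c / q))"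
    by (simp add: algebra_simps)
  finally show ?thesis by (simp add: q_def)
qed

text \<open>\<open>T\<close> is the gain from one more vertex of weight \<open>w\<close> in the
  class \<open>A\<close>. A set \<open>f\<close> of the common link is missed by those vertices of
  \<open>A\<close> that it contains, so summing over \<open>A\<close> counts it
  \<open>s - j f\<close> times. Ignoring \<open>j f\<close> gives the first bound. The second
  controls it through \<open>m\<close>, the mean of \<open>card (e \<inter> A)\<close> over edges
  weighted by their share of \<open>\<Lambda>\<close>.\<close>

lemma color_class_clone_gain:
  fixes \<phi> :: "'v \<Rightarrow> nat" and x :: "'v \<Rightarrow> real"
  assumes fin: "finite V" and x: "principal_eigenvector r \<alpha> (col_graph r E \<phi> V) x"
    and "1 < \<alpha>" "1 \<le> r" "0 < w"
    and A: "A = {v \<in> V. \<phi> v = i}" "A \<noteq> {}" "\<And>v. v \<in> A \<Longrightarrow> x v = w"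
  defines "\<Lambda> \<equiv> spec_radius r \<alpha> (col_graph r E \<phi> V)"
    and "T \<equiv> w * (fact r * (\<Sum>f\<in>col_link r E \<phi> i V. \<Prod>u\<in>f. x u))"
    and "s \<equiv> real (card A)" and "m \<equiv> real (card A) * real r * w powr \<alpha>"
  shows "m * \<Lambda> \<le> s * T" "m < s + 1 \<Longrightarrow> m * \<Lambda> \<le> (s + 1 - m) * T"
proof -
  have a0: "0 < \<alpha>" using assms by simp
  note px = principal_eigenvectorD[OF x a0, simplified]
  define L W j where "L = col_link r E \<phi> i V" and "W f = (\<Prod>u\<in>f. x u)"
    and "j f = real (card (f \<inter> A))" for f
  have AV: "A \<subseteq> V" and finA: "finite A" and finL: "finite L"
    using A fin finite_col_link by (auto simp: L_def)
  have W0: "0 \<le> W f" if "f \<subseteq> V" for f using that px(1) by (auto simp: W_def intro!: prod_nonneg)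
  have WL: "0 \<le> W f" if "f \<in> L" for f using that by (intro W0) (simp add: L_def col_link_def)
  have link: "col_link r E \<phi> (\<phi> v) (V - {v}) = {f \<in> L. v \<notin> f}" if "v \<in> A" for v
    using that A by (simp add: col_link_Diff L_def)
  have swap: "(\<Sum>v\<in>A. \<Sum>f\<in>{f \<in> L. v \<notin> f}. g f) = (\<Sum>f\<in>L. (s - j f) * g f)" for g :: "'v set \<Rightarrow> real"
  proof -
    have "(\<Sum>v\<in>A. \<Sum>f\<in>{f \<in> L. v \<notin> f}. g f) = (\<Sum>f\<in>L. \<Sum>v\<in>{v \<in> A. v \<notin> f}. g f)"
      by (rule sum.swap_restrict[OF finA finL])
    also have "\<dots> = (\<Sum>f\<in>L. (s - j f) * g f)"
    proof (intro sum.cong refl)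
      fix f
      have "{v \<in> A. v \<notin> f} = A - f \<inter> A" by blast
      hence "card {v \<in> A. v \<notin> f} = card A - card (f \<inter> A)" using finA by (simp add: card_Diff_subset)
      hence "real (card {v \<in> A. v \<notin> f}) = s - j f"
        using card_mono[OF finA, of "f \<inter> A"] by (simp add: s_def j_def of_nat_diff)
      thus "(\<Sum>v\<in>{v \<in> A. v \<notin> f}. g f) = (s - j f) * g f" by simp
    qed
    finally show ?thesis .
  qed
  have deriv: "w * poly_deriv r (col_graph r E \<phi> V) v x = real r * \<Lambda> * w powr \<alpha>" if v: "v \<in> A" for v
    using eigen_equation[OF rgraph_col_graph[OF fin] x a0 \<open>1 \<le> r\<close>, of v] v A AV \<open>0 < w\<close>
    by (auto simp: \<Lambda>_def powr_diff)
  have "m * \<Lambda> = (\<Sum>v\<in>A. w * poly_deriv r (col_graph r E \<phi> V) v x)"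
    using deriv by (simp add: m_def mult_ac)
  also have "\<dots> = (\<Sum>v\<in>A. w * (fact r * (\<Sum>f\<in>{f \<in> L. v \<notin> f}. W f)))"
    using AV by (intro sum.cong refl) (auto simp: poly_deriv_col_graph[OF fin] link W_def)
  also have "\<dots> = w * fact r * (\<Sum>v\<in>A. \<Sum>f\<in>{f \<in> L. v \<notin> f}. W f)"
    by (simp add: sum_distrib_left mult_ac)
  finally have mL: "m * \<Lambda> = w * fact r * (\<Sum>f\<in>L. (s - j f) * W f)" by (simp add: swap)
  also have "\<dots> \<le> w * fact r * (\<Sum>f\<in>L. s * W f)"
    using \<open>0 < w\<close> WL by (intro mult_left_mono sum_mono mult_right_mono) (auto simp: j_def)
  also have "\<dots> = s * T" by (simp add: T_def L_def W_def sum_distrib_left mult_ac)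
  finally show "m * \<Lambda> \<le> s * T" .
  assume ms: "m < s + 1"
  define K where "K = col_edges r E \<phi> V"
  have finK: "finite K" using rgraph_finite_edges[OF rgraph_col_graph[OF fin]] by (simp add: K_def)
  have WK: "0 \<le> W e" if "e \<in> K" for e using that by (intro W0) (simp add: K_def col_edges_def)
  have J1: "fact r * (\<Sum>e\<in>K. j e * W e) = m * \<Lambda>"
  proof -
    have "(\<Sum>v\<in>A. x v * poly_deriv r (col_graph r E \<phi> V) v x) = m * \<Lambda>"
      using deriv A by (simp add: m_def mult_ac)
    thus ?thesis using sum_poly_deriv[OF rgraph_col_graph[OF fin] finA, of x r E \<phi>]
      by (simp add: K_def j_def W_def)
  qed
  \<comment> \<open>The second moment, rewritten over the link: one factor \<open>j e\<close>
    selects a vertex of \<open>e\<close> in \<open>A\<close>. Removing it leaves \<open>f\<close>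
    with \<open>j e = j f + 1\<close>.\<close>
  have J2: "(\<Sum>e\<in>K. j e * (j e * W e)) = w * (\<Sum>f\<in>L. (s - j f) * ((j f + 1) * W f))"
  proof -
    have "(\<Sum>e\<in>K. j e * (j e * W e)) = (\<Sum>e\<in>K. \<Sum>v\<in>{v \<in> A. v \<in> e}. j e * W e)"
      by (intro sum.cong refl) (auto simp: j_def Int_def conj_commute)
    also have "\<dots> = (\<Sum>v\<in>A. \<Sum>e\<in>{e \<in> K. v \<in> e}. j e * W e)"
      by (rule sum.swap_restrict[OF finK finA])
    also have "\<dots> = (\<Sum>v\<in>A. \<Sum>f\<in>{f \<in> L. v \<notin> f}. w * ((j f + 1) * W f))"
    proof (rule sum.cong[OF refl])
      fix v assume v: "v \<in> A"
      hence vV: "v \<in> V" using AV by blast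
      have "(\<Sum>e\<in>{e \<in> K. v \<in> e}. j e * W e) = (\<Sum>f\<in>{f \<in> L. v \<notin> f}. j (insert v f) * W (insert v f))"
        unfolding K_def sum_col_edges_containing[OF fin vV] link[OF v] ..
      also have "\<dots> = (\<Sum>f\<in>{f \<in> L. v \<notin> f}. w * ((j f + 1) * W f))"
      proof (intro sum.cong refl)
        fix f assume f: "f \<in> {f \<in> L. v \<notin> f}"
        hence "finite f" using fin finite_subset by (auto simp: L_def col_link_def)
        thus "j (insert v f) * W (insert v f) = w * ((j f + 1) * W f)"
          using f v A by (simp add: j_def W_def)
      qed
      finally show "(\<Sum>e\<in>{e \<in> K. v \<in> e}. j e * W e) = (\<Sum>f\<in>{f \<in> L. v \<notin> f}. w * ((j f + 1) * W f))" .
    qed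
    also have "\<dots> = w * (\<Sum>f\<in>L. (s - j f) * ((j f + 1) * W f))"
      unfolding swap by (simp add: sum_distrib_left mult_ac)
    finally show ?thesis .
  qed
  have P: "fact r * (\<Sum>e\<in>K. W e) = \<Lambda>" using px(3) by (simp add: poly_form_def K_def W_def \<Lambda>_def)
  txt \<open>The variance of \<open>\<bar>e \<inter> A\<bar>\<close> over the edges, weighted by \<open>W\<close>, is nonnegative; its mean is \<open>m\<close>.\<close>
  have "0 \<le> fact r * (\<Sum>e\<in>K. (j e - m)\<^sup>2 * W e)"
    using WK by (intro mult_nonneg_nonneg sum_nonneg) auto
  also have "\<dots> = fact r * (\<Sum>e\<in>K. j e * (j e * W e)) - 2 * m * (fact r * (\<Sum>e\<in>K. j e * W e))
      + m\<^sup>2 * (fact r * (\<Sum>e\<in>K. W e))"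
    by (simp add: sum_distrib_left power2_eq_square algebra_simps flip: sum_subtractf sum.distrib)
  also have "\<dots> = fact r * (w * (\<Sum>f\<in>L. (s - j f) * ((j f + 1) * W f))) - m * (m * \<Lambda>)"
    unfolding J1 J2 P by (simp add: power2_eq_square)
  also have "\<dots> = w * fact r * (\<Sum>f\<in>L. (s - j f) * (j f + 1 - m) * W f)"
    unfolding mL by (simp add: sum_distrib_left algebra_simps flip: sum_subtractf)
  finally have "0 \<le> w * fact r * (\<Sum>f\<in>L. (s - j f) * (j f + 1 - m) * W f)" .
  \<comment> \<open>Replacing \<open>s - j f\<close> by the constant \<open>s + 1 - m\<close> adds
    the square of \<open>j f + 1 - m\<close>. The positive constant can then be divided out, leaving
    a sum that is linear in \<open>j f\<close>.\<close>
  also have "\<dots> \<le> w * fact r * (\<Sum>f\<in>L. (s + 1 - m) * (j f + 1 - m) * W f)"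
  proof (rule mult_left_mono[OF sum_mono])
    fix f assume f: "f \<in> L"
    have "(s + 1 - m) * (j f + 1 - m) - (s - j f) * (j f + 1 - m) = (j f + 1 - m)\<^sup>2"
      by (simp add: power2_eq_square algebra_simps)
    hence "(s - j f) * (j f + 1 - m) \<le> (s + 1 - m) * (j f + 1 - m)"
      by (metis diff_ge_0_iff_ge zero_le_power2)
    thus "(s - j f) * (j f + 1 - m) * W f \<le> (s + 1 - m) * (j f + 1 - m) * W f"
      using WL[OF f] by (rule mult_right_mono)
  qed (use \<open>0 < w\<close> in auto)
  also have "\<dots> = (s + 1 - m) * (w * fact r * (\<Sum>f\<in>L. (j f + 1 - m) * W f))"
    by (simp add: sum_distrib_left mult_ac)
  finally have "0 \<le> w * fact r * (\<Sum>f\<in>L. (j f + 1 - m) * W f)"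
    using ms by (simp add: zero_le_mult_iff)
  also have "\<dots> = w * fact r * (\<Sum>f\<in>L. (s + 1 - m) * W f) - w * fact r * (\<Sum>f\<in>L. (s - j f) * W f)"
    by (simp add: sum_distrib_left algebra_simps flip: sum_subtractf)
  also have "\<dots> = (s + 1 - m) * T - m * \<Lambda>"
    unfolding mL by (simp add: T_def L_def W_def sum_distrib_left mult_ac)
  finally show "m * \<Lambda> \<le> (s + 1 - m) * T" by simp
qed

lemma large_color_class:
  assumes "finite V" "\<phi> ` V \<subseteq> {1..l}" "V \<noteq> {}"
  obtains i where "{v \<in> V. \<phi> v = i} \<noteq> {}" "real (card V) \<le> real l * real (card {v \<in> V. \<phi> v = i})"
proof -
  have sum: "(\<Sum>i\<in>{1..l}. real (card {v \<in> V. \<phi> v = i})) = real (card V)"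
    using sum.group[OF assms(1) _ assms(2), of "\<lambda>_. 1::real"] by simp
  have "\<exists>i\<in>{1..l}. real (card V) \<le> real l * real (card {v \<in> V. \<phi> v = i})"
  proof (rule ccontr)
    assume neg: "\<not> ?thesis"
    have "{1..l} \<noteq> {}" using assms by auto
    hence "(\<Sum>i\<in>{1..l}. real l * real (card {v \<in> V. \<phi> v = i})) < (\<Sum>i\<in>{1..l}. real (card V))"
      using neg by (intro sum_strict_mono) (auto simp: not_le)
    also have "\<dots> = real l * real (card V)" by simp
    finally show False using sum by (simp flip: sum_distrib_left)
  qed
  then obtain i where i: "real (card V) \<le> real l * real (card {v \<in> V. \<phi> v = i})" by blast
  have "{v \<in> V. \<phi> v = i} \<noteq> {}"
  proof
    assume "{v \<in> V. \<phi> v = i} = {}"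
    hence "card V = 0" using i by (simp only: card.empty of_nat_0 mult_zero_right of_nat_le_0_iff)
    thus False using assms by simp
  qed
  thus thesis using that i by blast
qed

text \<open>A vertex is added to a class of at least average size, with the common weight of that
  class. The parameter \<open>t\<close> will be \<open>x_min powr \<alpha>\<close>; only its being a
  lower bound for all entries of one positive eigenvector matters.\<close>

lemma spec_radius_fam_growth:
  assumes pat: "is_pattern r (l, E)" "E \<noteq> {}" "1 \<le> r" and "1 < \<alpha>"
    and n: "real l * real r < real n" "real l / (\<alpha> - 1) \<le> real n - real l * real r"
    and G: "spec_extremal r \<alpha> (Col r (l, E)) n G"
    and xG: "principal_eigenvector r \<alpha> G x" and pos: "\<And>v. v \<in> verts G \<Longrightarrow> 0 < x v"
    and t: "\<And>v. v \<in> verts G \<Longrightarrow> t \<le> x v powr \<alpha>" "0 \<le> t"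
  shows "(1 + real r * (1 - 1 / \<alpha> - real l / (\<alpha> * (real n - real l * real r + real l))) * t)
      * spec_radius_fam r \<alpha> (Col r (l, E)) n \<le> spec_radius_fam r \<alpha> (Col r (l, E)) (Suc n)"
proof -
  define V \<Lambda> \<Lambda>' where "V = verts G" and "\<Lambda> = spec_radius_fam r \<alpha> (Col r (l, E)) n"
    and "\<Lambda>' = spec_radius_fam r \<alpha> (Col r (l, E)) (Suc n)"
  have a0: "0 < \<alpha>" using assms by simp
  have l: "1 \<le> l" using pat by (simp add: is_pattern_def)
  have "1 * real r \<le> real l * real r" using l by (intro mult_right_mono) auto
  hence "real r < real n" using n(1) by linarith
  hence rn: "r \<le> n" and n1: "1 \<le> n" by auto
  have card: "card V = n" and fin: "finite V"
    using G by (auto simp: V_def spec_extremal_def Col_def rgraph_def)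
  obtain \<phi> where \<phi>: "\<phi> ` V \<subseteq> {1..l}"
    and x: "principal_eigenvector r \<alpha> (col_graph r E \<phi> V) x"
    and lam: "spec_radius r \<alpha> (col_graph r E \<phi> V) = \<Lambda>"
    using spec_extremal_completion[OF G n1 a0 xG] unfolding V_def \<Lambda>_def by blast
  note px = principal_eigenvectorD[OF x a0, simplified]
  have L: "0 < \<Lambda>" unfolding \<Lambda>_def using assms a0 rn by (intro spec_radius_fam_pos) auto
  have "V \<noteq> {}" using card n1 by auto
  then obtain i where i: "{v \<in> V. \<phi> v = i} \<noteq> {}" "real n \<le> real l * real (card {v \<in> V. \<phi> v = i})"
    using large_color_class[OF fin \<phi>] unfolding card by blast
  define A where "A = {v \<in> V. \<phi> v = i}"
  then obtain v where v: "v \<in> V" "\<phi> v = i" using i by blast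
  define w s where "w = x v" and "s = real (card A)"
  have finA: "finite A" using fin by (simp add: A_def)
  have w: "0 < w" using pos v by (simp add: w_def V_def)
  have xw: "x u = w" if "u \<in> A" for u
    using principal_eigenvector_same_color[OF fin x _ \<open>1 < \<alpha>\<close> pat(3) pos, of u v] that v lam L
    by (simp add: A_def w_def V_def)
  define \<tau> where "\<tau> = w powr \<alpha>"
  define m where "m = s * real r * \<tau>"
  define T where "T = w * (fact r * (\<Sum>f\<in>col_link r E \<phi> i V. \<Prod>u\<in>f. x u))"
  have "s * \<tau> = (\<Sum>u\<in>A. x u powr \<alpha>)" using xw by (simp add: s_def \<tau>_def)
  also have "\<dots> \<le> (\<Sum>u\<in>V. x u powr \<alpha>)" using fin by (intro sum_mono2) (auto simp: A_def)
  finally have s\<tau>: "s * \<tau> \<le> 1" using px by simp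
  have mr: "m \<le> real r" "0 \<le> m" using mult_left_mono[OF s\<tau>, of "real r"] by (auto simp: m_def mult_ac s_def \<tau>_def)
  have ls: "real n \<le> real l * s" using i by (simp add: s_def A_def)
  have "real l * real r < real l * s" using ls n(1) by linarith
  hence rs: "real r < s" using l by simp
  have gain: "m * \<Lambda> \<le> s * T" "m * \<Lambda> \<le> (s + 1 - m) * T"
    using color_class_clone_gain[OF fin x \<open>1 < \<alpha>\<close> pat(3) w A_def _ xw] i rs mr lam
    by (simp_all add: A_def[symmetric] m_def s_def \<tau>_def T_def)
  obtain u where u: "u \<notin> V" using fin ex_new_if_finite[OF infinite_UNIV_nat] by blast
  define \<psi> y where "\<psi> = \<phi>(u := i)" and "y = x(u := w)"
  have cong: "col_edges r E \<psi> V = col_edges r E \<phi> V" "col_link r E \<psi> i V = col_link r E \<phi> i V" for i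
    using fin u by (auto intro!: col_edges_cong col_link_cong simp: \<psi>_def)
  let ?H = "col_graph r E \<psi> (insert u V)"
  have rH: "rgraph r ?H" using fin by (intro rgraph_col_graph) auto
  have linkeq: "(\<Sum>f\<in>col_link r E \<phi> i V. \<Prod>w\<in>f. y w) = (\<Sum>f\<in>col_link r E \<phi> i V. \<Prod>w\<in>f. x w)"
    using u by (intro sum.cong prod.cong) (auto simp: y_def col_link_def)
  have "poly_form r (col_graph r E \<psi> V) y = poly_form r (col_graph r E \<phi> V) x"
    unfolding poly_form_def edges_col_graph cong using u
    by (intro arg_cong[where f = "(*) _"] sum.cong prod.cong) (auto simp: y_def col_edges_def)
  hence Py: "poly_form r ?H y = \<Lambda> + T"
    using poly_form_col_graph_insert[OF fin u, of r E \<psi> y] px lam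
    by (simp add: cong linkeq \<psi>_def[THEN fun_cong, of u] T_def) (simp add: y_def)
  have "(\<Sum>z\<in>insert u V. \<bar>y z\<bar> powr \<alpha>) = \<tau> + (\<Sum>z\<in>V. \<bar>y z\<bar> powr \<alpha>)"
    using fin u w by (simp add: y_def \<tau>_def)
  also have "(\<Sum>z\<in>V. \<bar>y z\<bar> powr \<alpha>) = (\<Sum>z\<in>V. x z powr \<alpha>)"
    using u px(1) by (intro sum.cong) (auto simp: y_def)
  finally have norm: "(\<Sum>z\<in>insert u V. \<bar>y z\<bar> powr \<alpha>) = 1 + \<tau>" using px by simp
  have H: "\<Lambda> + T \<le> \<Lambda>' * (1 + \<tau>) powr (r / \<alpha>)"
  proof -
    have "\<Lambda> + T \<le> spec_radius r \<alpha> ?H * (1 + \<tau>) powr (r / \<alpha>)"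
      using poly_form_le_homogeneous[OF rH a0 pat(3), of y] norm Py by simp
    also have "\<dots> \<le> \<Lambda>' * (1 + \<tau>) powr (r / \<alpha>)"
      unfolding \<Lambda>'_def
    proof (intro mult_right_mono spec_radius_le_fam col_graph_in_Col)
      show "\<psi> ` insert u V \<subseteq> {1..l}" using \<phi> v u by (auto simp: \<psi>_def)
    qed (use fin u card a0 in auto)
    finally show ?thesis .
  qed
  define c p X where "c = 1 / \<alpha>" and "p = real r * \<tau>" and "X = T / \<Lambda>"
  have c: "0 \<le> c" "c \<le> 1" using assms by (auto simp: c_def)
  have s0: "0 < s" using rs by simp
  have ps: "p = m / s" using s0 by (simp add: p_def m_def)
  have p1: "0 \<le> p" "p \<le> 1" using mr rs s0 by (auto simp: ps divide_le_eq)
  have cp: "c * p \<le> 1" using mult_mono[OF c(2) p1(2)] p1 by simp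
  have LX: "\<Lambda> + T = \<Lambda> * (1 + X)" using L by (simp add: X_def field_simps)
  have L': "0 \<le> \<Lambda>'" unfolding \<Lambda>'_def using a0 rn by (intro less_imp_le spec_radius_fam_pos pat) auto
  \<comment> \<open>This makes \<open>1 - c * p\<close> a lower bound for the inverse of the
    normalising factor.\<close>
  have "(1 + \<tau>) powr (r / \<alpha>) * (1 - c * p) \<le> exp (c * p) * exp (- (c * p))"
  proof (intro mult_mono)
    have "(1 + \<tau>) powr (r / \<alpha>) \<le> exp \<tau> powr (r / \<alpha>)" using a0 by (intro powr_mono2) (auto simp: \<tau>_def)
    thus "(1 + \<tau>) powr (r / \<alpha>) \<le> exp (c * p)" by (simp add: powr_def c_def p_def mult_ac)
    show "1 - c * p \<le> exp (- (c * p))" using exp_ge_add_one_self[of "- (c * p)"] by simp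
  qed (use cp in auto)
  hence e1: "(1 + \<tau>) powr (r / \<alpha>) * (1 - c * p) \<le> 1" by (simp flip: exp_add)
  have "\<Lambda> * ((1 + X) * (1 - c * p)) \<le> \<Lambda>' * (1 + \<tau>) powr (r / \<alpha>) * (1 - c * p)"
    using mult_right_mono[OF H, of "1 - c * p"] cp by (simp add: LX mult.assoc)
  also have "\<dots> \<le> \<Lambda>' * 1" unfolding mult.assoc using e1 L' by (intro mult_left_mono) auto
  finally have up: "\<Lambda> * ((1 + X) * (1 - c * p)) \<le> \<Lambda>'" by simp
  define D k where "D = real n - real l * real r + real l" and "k = 1 - 1 / \<alpha> - real l / (\<alpha> * D)"
  have D0: "0 < D" using n l by (simp add: D_def)
  \<comment> \<open>The assumption \<open>l / (\<alpha> - 1) \<le> n - l * r\<close> enters here: a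
    negative \<open>k\<close> would reverse the later passage from \<open>t\<close> to the larger
    \<open>\<tau>\<close>.\<close>
  have k0: "0 \<le> k"
  proof -
    have "real l \<le> (\<alpha> - 1) * D"
    proof -
      have "real l \<le> (\<alpha> - 1) * (real n - real l * real r)"
        using n(2) \<open>1 < \<alpha>\<close> by (simp add: divide_le_eq mult.commute)
      also have "\<dots> \<le> (\<alpha> - 1) * D" using \<open>1 < \<alpha>\<close> by (intro mult_left_mono) (auto simp: D_def)
      finally show ?thesis .
    qed
    moreover have "k = ((\<alpha> - 1) * D - real l) / (\<alpha> * D)"
      using a0 D0 by (simp add: k_def diff_divide_distrib)
    ultimately show ?thesis using a0 D0 by simp
  qed
  \<comment> \<open>Origin of the denominator in (1): \<open>s \<ge> n / l\<close> turns
    \<open>l * (s - r + 1)\<close> into at least \<open>n - l * r + l\<close>.\<close>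
  have "D \<le> real l * (s - real r + 1)" using ls by (simp add: D_def algebra_simps)
  hence "1 / (s - real r + 1) \<le> real l / D" using D0 rs by (simp add: field_simps)
  hence "c * (1 / (s - real r + 1)) \<le> c * (real l / D)" using c by (intro mult_left_mono) auto
  hence kk: "k \<le> 1 - c - c / (s - real r + 1)" by (simp add: k_def c_def)
  have "t \<le> \<tau>" using t(1) v by (simp add: \<tau>_def w_def V_def)
  hence "k * (real r * t) \<le> k * p" unfolding p_def using k0 by (intro mult_left_mono) auto
  also have "\<dots> \<le> p * (1 - c - c / (s - real r + 1))"
    using mult_left_mono[OF kk p1(1)] by (simp add: mult.commute)
  finally have "1 + k * (real r * t) \<le> 1 + p * (1 - c - c / (s - real r + 1))" by simp
  also have "\<dots> \<le> (1 + X) * (1 - c * p)"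
  proof (rule clone_gain_arith[OF mr(2,1) rs ps c])
    show "m \<le> s * X" "m \<le> (s + 1 - m) * X" using gain L by (simp_all add: X_def pos_le_divide_eq)
  qed
  finally have "\<Lambda> * (1 + k * (real r * t)) \<le> \<Lambda> * ((1 + X) * (1 - c * p))"
    using L by (intro mult_left_mono) auto
  hence "\<Lambda> * (1 + k * (real r * t)) \<le> \<Lambda>'" using up by linarith
  thus ?thesis by (simp add: \<Lambda>_def \<Lambda>'_def k_def D_def mult_ac)
qed

section \<open>Minimum degree\<close>

text \<open>Linearises a product of factors near 1; the uniform bound \<open>c\<close> on the
  excesses absorbs all higher-order terms into the power of \<open>1 + c\<close>.\<close>

lemma prod_le_one_plus_sum:
  fixes z \<eta> :: "'a \<Rightarrow> real"
  assumes "finite F" "0 \<le> c" and "\<And>u. u \<in> F \<Longrightarrow> 0 \<le> z u \<and> z u \<le> 1 + \<eta> u \<and> 0 \<le> \<eta> u \<and> \<eta> u \<le> c"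
  shows "(\<Prod>u\<in>F. z u) \<le> 1 + (1 + c) ^ card F * (\<Sum>u\<in>F. \<eta> u)"
  using assms(1,3)
proof (induction F rule: finite_induct)
  case (insert a F)
  let ?S = "\<Sum>u\<in>F. \<eta> u" and ?q = "(1 + c) ^ card F"
  have S: "0 \<le> ?S" using insert by (intro sum_nonneg) auto
  have a: "0 \<le> z a" "z a \<le> 1 + \<eta> a" "0 \<le> \<eta> a" "\<eta> a \<le> c" using insert by auto
  have q: "1 \<le> ?q * (1 + c)" using one_le_power[of "1 + c" "Suc (card F)"] assms(2) by (simp add: mult.commute)
  have "z a * (\<Prod>u\<in>F. z u) \<le> (1 + \<eta> a) * (1 + ?q * ?S)"
    using insert a by (intro mult_mono) (auto intro!: prod_nonneg)
  also have "\<dots> = 1 + 1 * \<eta> a + ?q * ?S * (1 + \<eta> a)" by (simp add: algebra_simps)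
  also have "\<dots> \<le> 1 + ?q * (1 + c) * \<eta> a + ?q * ?S * (1 + c)"
    using a S q assms(2) by (intro add_mono mult_left_mono mult_right_mono) auto
  also have "\<dots> = 1 + (1 + c) ^ card (insert a F) * (\<Sum>u\<in>insert a F. \<eta> u)"
    using insert by (simp add: algebra_simps)
  finally show ?case using insert by simp
qed simp

lemma card_subsets_containing:
  assumes "finite V" "u \<in> V"
  shows "card V * card {f. f \<subseteq> V \<and> card f = k \<and> u \<in> f} = k * (card V choose k)"
proof (cases k)
  case 0
  hence "\<not> (f \<subseteq> V \<and> card f = k \<and> u \<in> f)" for f
    using assms(1) finite_subset[of f V] by auto
  hence "{f. f \<subseteq> V \<and> card f = k \<and> u \<in> f} = {}" by blast
  thus ?thesis using 0 by (simp only: card.empty mult_0 mult_0_right)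
next
  case (Suc j)
  \<comment> \<open>With every multiset allowed and a single colour, \<open>col_graph\<close> is the
    complete \<open>k\<close>-graph, so the count is a vertex degree.\<close>
  have "{f. f \<subseteq> V \<and> card f = k \<and> u \<in> f} = {e \<in> edges (col_graph k UNIV (\<lambda>_. 0) V). u \<in> e}"
    by (auto simp: col_edges_def)
  hence "card {f. f \<subseteq> V \<and> card f = k \<and> u \<in> f} = card (col_link k UNIV (\<lambda>_. 0) 0 (V - {u}))"
    using vdegree_col_graph[OF assms, of k UNIV "\<lambda>_. 0"] by (simp add: vdegree_def)
  also have "col_link k UNIV (\<lambda>_. 0) 0 (V - {u}) = {f. f \<subseteq> V - {u} \<and> card f = j}"
    by (auto simp: col_link_def Suc)
  also have "card \<dots> = (card V - 1) choose j" using assms by (simp add: n_subsets)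
  finally show ?thesis using times_binomial_minus1_eq[of k "card V"] by (simp add: Suc)
qed

text \<open>After linearising each product and exchanging sums, the excess \<open>\<eta> u\<close>
  is counted once per edge through \<open>u\<close> and \<open>v\<close>, hence at most
  \<open>k / n * (n choose k)\<close> times. A bounded total excess therefore costs only a relative
  error of order \<open>1 / n\<close>.\<close>

lemma poly_deriv_balanced_le:
  fixes z \<eta> :: "'v \<Rightarrow> real"
  assumes G: "rgraph r G" and v: "v \<in> verts G" and "0 \<le> c"
    and z: "\<And>u. u \<in> verts G \<Longrightarrow> 0 \<le> z u \<and> z u \<le> 1 + \<eta> u \<and> 0 \<le> \<eta> u"
    and c: "(\<Sum>u\<in>verts G. \<eta> u) \<le> c"
  defines "n \<equiv> real (card (verts G))" and "k \<equiv> r - 1"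
  shows "poly_deriv r G v z \<le>
    fact r * (real (vdegree G v) + (1 + c) ^ k * (c * real k) * real (card (verts G) choose k) / n)"
proof -
  define V where "V = verts G"
  have fin: "finite V" using G by (simp add: rgraph_def V_def)
  have npos: "0 < n" using v fin by (auto simp: n_def V_def card_gt_0_iff)
  define K where "K = {e \<in> edges G. v \<in> e}"
  have finK: "finite K" using rgraph_finite_edges[OF G] by (simp add: K_def)
  have K: "finite e" "e \<subseteq> V" "card (e - {v}) = k" "v \<in> e" if "e \<in> K" for e
    using that rgraph_edgeD[OF G, of e] by (auto simp: K_def V_def k_def)
  have \<eta>c: "\<eta> u \<le> c" if "u \<in> V" for u
    using member_le_sum[of u V \<eta>] that z fin c by (auto simp: V_def)
  have "(\<Sum>e\<in>K. \<Prod>u\<in>e - {v}. z u) \<le> (\<Sum>e\<in>K. 1 + (1 + c) ^ k * (\<Sum>u\<in>e - {v}. \<eta> u))"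
  proof (rule sum_mono)
    fix e assume e: "e \<in> K"
    have "(\<Prod>u\<in>e - {v}. z u) \<le> 1 + (1 + c) ^ card (e - {v}) * (\<Sum>u\<in>e - {v}. \<eta> u)"
      using K[OF e] z \<eta>c assms(3) by (intro prod_le_one_plus_sum) (auto simp: V_def)
    thus "(\<Prod>u\<in>e - {v}. z u) \<le> 1 + (1 + c) ^ k * (\<Sum>u\<in>e - {v}. \<eta> u)" using K[OF e] by simp
  qed
  also have "\<dots> = real (card K) + (1 + c) ^ k * (\<Sum>e\<in>K. \<Sum>u\<in>e - {v}. \<eta> u)"
    by (simp add: sum.distrib sum_distrib_left)
  also have "(\<Sum>e\<in>K. \<Sum>u\<in>e - {v}. \<eta> u) \<le> c * (real k * real (card V choose k) / n)"
  proof -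
    have "(\<Sum>e\<in>K. \<Sum>u\<in>e - {v}. \<eta> u) = (\<Sum>e\<in>K. \<Sum>u\<in>{u \<in> V. u \<in> e - {v}}. \<eta> u)"
      using K by (intro sum.cong) auto
    also have "\<dots> = (\<Sum>u\<in>V. \<Sum>e\<in>{e \<in> K. u \<in> e - {v}}. \<eta> u)"
      by (rule sum.swap_restrict[OF finK fin])
    also have "\<dots> = (\<Sum>u\<in>V. real (card {e \<in> K. u \<in> e - {v}}) * \<eta> u)" by simp
    also have "\<dots> \<le> (\<Sum>u\<in>V. (real k * real (card V choose k) / n) * \<eta> u)"
    proof (intro sum_mono mult_right_mono)
      fix u assume u: "u \<in> V"
      show "0 \<le> \<eta> u" using z u by (auto simp: V_def)
      have "inj_on (\<lambda>e. e - {v}) {e \<in> K. u \<in> e - {v}}"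
        by (rule inj_onI) (auto simp: K_def)
      moreover have "(\<lambda>e. e - {v}) ` {e \<in> K. u \<in> e - {v}} \<subseteq> {f. f \<subseteq> V \<and> card f = k \<and> u \<in> f}"
        using K by auto
      ultimately have "card {e \<in> K. u \<in> e - {v}} \<le> card {f. f \<subseteq> V \<and> card f = k \<and> u \<in> f}"
        using fin by (intro card_inj_on_le) auto
      hence "card V * card {e \<in> K. u \<in> e - {v}} \<le> k * (card V choose k)"
        unfolding card_subsets_containing[OF fin u, of k, symmetric] by (rule mult_left_mono) simp
      hence "n * real (card {e \<in> K. u \<in> e - {v}}) \<le> real k * real (card V choose k)"
        unfolding n_def V_def[symmetric] by (simp flip: of_nat_mult)
      thus "real (card {e \<in> K. u \<in> e - {v}}) \<le> real k * real (card V choose k) / n"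
        using npos by (simp add: pos_le_divide_eq mult.commute)
    qed
    also have "\<dots> = (real k * real (card V choose k) / n) * (\<Sum>u\<in>V. \<eta> u)" by (simp add: sum_distrib_left)
    also have "\<dots> \<le> (real k * real (card V choose k) / n) * c"
      using c npos by (intro mult_left_mono) (auto simp: V_def)
    finally show ?thesis by (simp add: mult.commute)
  qed
  finally have "(\<Sum>e\<in>K. \<Prod>u\<in>e - {v}. z u) \<le>
      real (card K) + (1 + c) ^ k * (c * (real k * real (card V choose k) / n))"
    using assms(3) by (simp add: mult_left_mono)
  thus ?thesis unfolding poly_deriv_def vdegree_def K_def[symmetric] V_def[symmetric]
    by (intro mult_left_mono) (simp_all add: mult_ac)
qed

text \<open>Since the entries \<open>x\<^sub>u\<^sup>\<alpha>\<close> are at least \<open>1/n - C/n\<^sup>2\<close> and add up to 1, the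
  total deviation of \<open>n x\<^sub>u\<^sup>\<alpha>\<close> from 1 is bounded, so replacing \<open>x\<close> by the uniform vector in the
  link of \<open>v\<close> costs only a relative error of order \<open>1/n\<close>.\<close>

lemma vdegree_ge:
  assumes pat: "is_pattern r (l, E)" "E \<noteq> {}" "1 \<le> r" and "1 < \<alpha>" and n: "r \<le> n" "C < real n"
    and C: "0 \<le> C"
    and G: "spec_extremal r \<alpha> (Col r (l, E)) n G"
    and x: "principal_eigenvector r \<alpha> G x"
    and low: "\<And>u. u \<in> verts G \<Longrightarrow> 1 / real n - C / (real n)\<^sup>2 \<le> x u powr \<alpha>"
    and v: "v \<in> verts G"
  defines "\<pi> \<equiv> pi_hat r (Col r (l, E))" and "k \<equiv> r - 1"
  shows "\<pi> * (1 - (real k + C + (1 + C) ^ k * (C * real k) / \<pi>) / real n) * real (n choose k)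
    \<le> real (vdegree G v)"
proof -
  define V \<Lambda> N where "V = verts G" and "\<Lambda> = spec_radius_fam r \<alpha> (Col r (l, E)) n" and "N = real n"
  have a0: "0 < \<alpha>" using assms by simp
  have n0: "1 \<le> n" "0 < N" using n pat by (auto simp: N_def)
  have r: "r = Suc k" using pat by (simp add: k_def)
  have \<pi>: "0 < \<pi>" unfolding \<pi>_def by (rule pi_hat_bounds(1)[OF pat])
  have card: "card V = n" and rG: "rgraph r G" and lam: "spec_radius r \<alpha> G = \<Lambda>"
    using G by (auto simp: V_def \<Lambda>_def spec_extremal_def Col_def)
  note px = principal_eigenvectorD[OF x a0]
  have CN: "0 < 1 - C / N" using n n0 by (simp add: N_def divide_less_eq)
  have low': "(1 - C / N) / N \<le> x u powr \<alpha>" if "u \<in> V" for u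
    using low that n0 by (simp add: V_def N_def power2_eq_square diff_divide_distrib)
  have lowpos: "0 < (1 - C / N) / N" using CN n0 by simp
  have xpos: "0 < x u" if "u \<in> V" for u
    using low'[OF that] lowpos px(1)[of u] that by (cases "x u = 0") (auto simp: V_def)
  define a where "a = N powr (1 / \<alpha>)"
  have apos: "0 < a" using n0 by (simp add: a_def)
  \<comment> \<open>The scaling sends the uniform vector to the all-ones vector. The shift
    \<open>C / N\<close> is the least that the lower bound on the entries allows for nonnegative
    excesses, and the excesses then sum to exactly \<open>C\<close>.\<close>
  define z \<eta> where "z u = a * x u" and "\<eta> u = N * x u powr \<alpha> - 1 + C / N" for u
  have "(\<Sum>u\<in>V. \<eta> u) = N * (\<Sum>u\<in>V. x u powr \<alpha>) - real (card V) + real (card V) * (C / N)"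
    by (simp add: \<eta>_def sum.distrib sum_subtractf sum_distrib_left)
  also have "\<dots> = C" using px(2) card n0 by (simp add: V_def N_def)
  finally have sum\<eta>: "(\<Sum>u\<in>V. \<eta> u) = C" .
  have z: "0 \<le> z u \<and> z u \<le> 1 + \<eta> u \<and> 0 \<le> \<eta> u" if u: "u \<in> V" for u
  proof (intro conjI)
    show z0: "0 \<le> z u" using apos xpos[OF u] by (simp add: z_def)
    have "(1 - C / N) \<le> N * x u powr \<alpha>" using low'[OF u] n0 by (simp add: divide_le_eq mult.commute)
    thus \<eta>0: "0 \<le> \<eta> u" by (simp add: \<eta>_def)
    have "z u powr \<alpha> = N * x u powr \<alpha>"
      using a0 n0 xpos[OF u] by (simp add: z_def a_def powr_mult powr_powr)
    hence za: "z u powr \<alpha> \<le> 1 + \<eta> u" using C n0 by (simp add: \<eta>_def)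
    show "z u \<le> 1 + \<eta> u"
    proof (cases "z u \<le> 1")
      case False
      hence "z u powr 1 \<le> z u powr \<alpha>" using \<open>1 < \<alpha>\<close> by (intro powr_mono) auto
      thus ?thesis using za z0 by simp
    qed (use \<eta>0 in simp)
  qed
  define B where "B = (1 + C) ^ k * (C * real k)"
  have up: "poly_deriv r G v z \<le> fact r * (real (vdegree G v) + B * real (n choose k) / N)"
    using poly_deriv_balanced_le[OF rG v C, of z \<eta>] z sum\<eta> card
    by (simp add: V_def N_def B_def k_def)
  have scale: "poly_deriv r G v z = a ^ k * poly_deriv r G v x"
  proof -
    have "(\<Prod>u\<in>e - {v}. z u) = a ^ k * (\<Prod>u\<in>e - {v}. x u)" if "e \<in> {e \<in> edges G. v \<in> e}" for e
      using that rgraph_edgeD[OF rG, of e] by (simp add: z_def prod.distrib r)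
    thus ?thesis by (simp add: poly_deriv_def sum_distrib_left mult_ac)
  qed
  have eig: "poly_deriv r G v x = real r * \<Lambda> * x v powr (\<alpha> - 1)"
    using eigen_equation[OF rG x a0 pat(3) v] xpos v lam by (simp add: V_def)
  have vV: "v \<in> V" using v by (simp add: V_def)
  define \<gamma> where "\<gamma> = 1 - 1 / \<alpha>"
  have \<gamma>: "0 \<le> \<gamma>" "\<gamma> \<le> 1" using assms by (auto simp: \<gamma>_def)
  \<comment> \<open>The base lies in \<open>[0, 1]\<close> and the exponent \<open>\<gamma>\<close>
    is at most 1, so the power can be traded for an error linear in \<open>1 / N\<close>.\<close>
  have "(1 - C / N) powr 1 \<le> (1 - C / N) powr \<gamma>" using CN C n0 \<gamma> by (intro powr_mono') auto
  hence "(1 - C / N) * N powr (- \<gamma>) \<le> (1 - C / N) powr \<gamma> * N powr (- \<gamma>)"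
    using CN by (intro mult_right_mono) auto
  also have "\<dots> = ((1 - C / N) / N) powr \<gamma>" using CN n0 by (simp add: powr_divide powr_minus_divide)
  also have "\<dots> \<le> (x v powr \<alpha>) powr \<gamma>" using low'[OF vV] lowpos \<gamma> by (intro powr_mono2) auto
  also have "\<dots> = x v powr (\<alpha> - 1)" using a0 by (simp add: powr_powr \<gamma>_def right_diff_distrib)
  finally have xv: "(1 - C / N) * N powr (- \<gamma>) \<le> x v powr (\<alpha> - 1)" .
  have L: "fact r * (\<pi> * real (n choose r)) * N powr (- (r / \<alpha>)) \<le> \<Lambda>"
  proof -
    have "fact r * (\<pi> * real (n choose r)) \<le> fact r * real (ex_num (Col r (l, E)) n)"
      unfolding \<pi>_def using pi_hat_bounds(2)[OF pat n(1)] by (intro mult_left_mono) auto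
    also have "\<dots> \<le> \<Lambda> * N powr (r / \<alpha>)"
      unfolding \<Lambda>_def N_def using pat n0 a0
      by (intro ex_num_le_spec_radius_fam) (auto simp: is_pattern_def)
    finally show ?thesis using n0 by (simp add: powr_minus divide_simps)
  qed
  have "fact r * (\<pi> * real (n choose r)) * N powr (- (r / \<alpha>)) * ((1 - C / N) * N powr (- \<gamma>))
      \<le> \<Lambda> * x v powr (\<alpha> - 1)"
  proof (rule mult_mono[OF L xv])
    show "0 \<le> \<Lambda>" unfolding \<Lambda>_def using spec_radius_fam_pos[OF pat n(1) a0] by simp
  qed (use CN in simp)
  hence "(a ^ k * real r) * (fact r * (\<pi> * real (n choose r)) * N powr (- (r / \<alpha>)) * ((1 - C / N) * N powr (- \<gamma>)))
      \<le> (a ^ k * real r) * (\<Lambda> * x v powr (\<alpha> - 1))"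
    using apos by (intro mult_left_mono) auto
  also have "\<dots> = poly_deriv r G v z" by (simp add: scale eig)
  also note up
  also have "(a ^ k * real r) * (fact r * (\<pi> * real (n choose r)) * N powr (- (r / \<alpha>)) * ((1 - C / N) * N powr (- \<gamma>)))
      = fact r * (\<pi> * (real r * real (n choose r)) * (1 - C / N) * (a ^ k * N powr (- (r / \<alpha>)) * N powr (- \<gamma>)))"
    by (simp add: mult_ac)
  \<comment> \<open>The exponents \<open>k/\<alpha>\<close>, \<open>- r/\<alpha>\<close> and
    \<open>- (1 - 1/\<alpha>)\<close> add up to -1 because \<open>r = k + 1\<close>, so the final
    degree bound is free of \<alpha> in its leading term.\<close>
  also have "a ^ k * N powr (- (r / \<alpha>)) * N powr (- \<gamma>) = 1 / N"
  proof -
    have "a ^ k = N powr (real k / \<alpha>)" using n0 by (simp add: a_def powr_realpow[symmetric] powr_powr)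
    hence "a ^ k * N powr (- (r / \<alpha>)) * N powr (- \<gamma>) = N powr (real k / \<alpha> - r / \<alpha> - \<gamma>)"
      by (simp add: powr_diff powr_minus divide_inverse)
    also have "real k / \<alpha> - r / \<alpha> - \<gamma> = - 1" using a0 by (simp add: r \<gamma>_def field_simps)
    finally show ?thesis using n0 by (simp add: powr_minus_divide)
  qed
  finally have "\<pi> * (real r * real (n choose r)) * (1 - C / N) / N \<le>
      real (vdegree G v) + B * real (n choose k) / N"
    by (simp only: mult_le_cancel_left_pos[OF fact_gt_zero]) simp
  moreover have "real r * real (n choose r) = (N - real k) * real (n choose k)"
  proof -
    have "r * (n choose r) = (n - k) * (n choose k)"
      using times_binomial_minus1_eq[of r n] binomial_absorb_comp[of n k] by (simp add: r)
    thus ?thesis using n by (metis N_def of_nat_diff of_nat_mult r Suc_leD)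
  qed
  ultimately have deg: "\<pi> * ((N - real k) * real (n choose k)) * (1 - C / N) / N - B * real (n choose k) / N
      \<le> real (vdegree G v)" by simp
  have "1 - (real k + C) / N \<le> (1 - real k / N) * (1 - C / N)"
    using C n0 by (simp add: algebra_simps add_divide_distrib)
  hence "\<pi> * real (n choose k) * (1 - (real k + C) / N) \<le>
      \<pi> * real (n choose k) * ((1 - real k / N) * (1 - C / N))"
    using \<pi> by (intro mult_left_mono) auto
  also have "\<dots> = \<pi> * ((N - real k) * real (n choose k)) * (1 - C / N) / N"
    using n0 by (simp add: diff_divide_distrib right_diff_distrib left_diff_distrib mult_ac)
  finally have "\<pi> * real (n choose k) * (1 - (real k + C) / N) - B * real (n choose k) / N
      \<le> real (vdegree G v)" using deg by simp
  moreover have "\<pi> * (1 - (real k + C + B / \<pi>) / N) * real (n choose k) =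
      \<pi> * real (n choose k) * (1 - (real k + C) / N) - B * real (n choose k) / N"
    using \<pi> n0 by (simp add: field_simps)
  ultimately show ?thesis by (simp add: B_def N_def)
qed

text \<open>The set in the infimum is nonempty and bounded below by 0, so bounds uniform over all
  principal eigenvectors transfer to \<open>x_min\<close>.\<close>

lemma x_min_bounds:
  assumes "rgraph r G" "verts G \<noteq> {}" "0 < \<alpha>"
  shows "\<And>x v. principal_eigenvector r \<alpha> G x \<Longrightarrow> v \<in> verts G \<Longrightarrow> x_min r \<alpha> G \<le> x v"
    and "(\<And>x v. principal_eigenvector r \<alpha> G x \<Longrightarrow> v \<in> verts G \<Longrightarrow> b \<le> x v) \<Longrightarrow> b \<le> x_min r \<alpha> G"
proof -
  let ?S = "{Min (x ` verts G) | x. principal_eigenvector r \<alpha> G x}"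
  have fin: "finite (verts G)" using assms by (simp add: rgraph_def)
  have "bdd_below ?S"
  proof (rule bdd_belowI)
    fix y assume "y \<in> ?S"
    then obtain x where x: "y = Min (x ` verts G)" "principal_eigenvector r \<alpha> G x" by blast
    thus "0 \<le> y" using fin assms(2) by (auto simp: principal_eigenvector_def)
  qed
  thus "x_min r \<alpha> G \<le> x v" if "principal_eigenvector r \<alpha> G x" "v \<in> verts G" for x v
    unfolding x_min_def using that fin by (intro cInf_lower2[of "Min (x ` verts G)"]) auto
  have "?S \<noteq> {}" using exists_principal_eigenvector[OF assms] by blast
  thus "b \<le> x_min r \<alpha> G"
    if "\<And>x v. principal_eigenvector r \<alpha> G x \<Longrightarrow> v \<in> verts G \<Longrightarrow> b \<le> x v"
    unfolding x_min_def
  proof (rule cInf_greatest)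
    fix y assume "y \<in> ?S"
    then obtain x where x: "y = Min (x ` verts G)" "principal_eigenvector r \<alpha> G x" by blast
    thus "b \<le> y" using that fin assms(2) by auto
  qed
qed

theorem theorem3p10:
  fixes r l :: nat and E :: "nat multiset set" and \<alpha> :: real
    and G :: "nat \<Rightarrow> nat hypergraph"
  assumes "1 \<le> r"
    and "is_pattern r (l, E)"
    and "E \<noteq> {}"
    and "1 < \<alpha>"
    and "\<And>n. 1 \<le> n \<Longrightarrow> G n \<in> Col r (l, E) \<and> card (verts (G n)) = n \<and>
           spec_radius r \<alpha> (G n) = spec_radius_fam r \<alpha> (Col r (l, E)) n"
  shows "\<exists>n1::nat. \<exists>M::real. M > 0 \<and> (\<forall>n\<ge>n1.
      spec_radius r \<alpha> (G (n + 1)) \<ge>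
        (1 + real r * (1 - 1 / \<alpha> - real l / (\<alpha> * (real n - real l * real r + real l)))
             * x_min r \<alpha> (G n) powr \<alpha>) * spec_radius r \<alpha> (G n)
    \<and> x_min r \<alpha> (G n) powr \<alpha> \<ge>
        1 / real n * (1 - pi_hat r (Col r (l, E)) * M / (real r * real n))
    \<and> real (min_degree (G n)) \<ge>
        pi_hat r (Col r (l, E)) * (1 - M / real n) * real (n choose (r - 1)))"
proof -
  define \<pi> k C where "\<pi> = pi_hat r (Col r (l, E))" and "k = r - 1" and "C = gap_const r \<alpha>"
  have \<pi>: "0 < \<pi>" unfolding \<pi>_def by (rule pi_hat_bounds(1)[OF assms(2,3,1)])
  have a0: "0 < \<alpha>" using assms by simp
  have "0 < real r - real r / \<alpha>" using assms by (simp add: field_simps)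
  hence C: "0 \<le> C" unfolding C_def gap_const_def
    by (intro divide_nonneg_nonneg mult_nonneg_nonneg add_nonneg_nonneg) auto
  \<comment> \<open>\<open>M1\<close> is the error constant of the degree bound. In \<open>M\<close>
    the summand \<open>r * C / \<pi>\<close> converts the gap \<open>C\<close> into the shape
    required by (2), and the summand 1 makes \<open>M\<close> positive.\<close>
  define M1 where "M1 = real k + C + (1 + C) ^ k * (C * real k) / \<pi>"
  define M where "M = 1 + M1 + real r * C / \<pi>"
  have M1: "0 \<le> M1" using C \<pi> by (simp add: M1_def)
  have M0: "0 < M" "M1 \<le> M" "real r * C / \<pi> \<le> M"
    using M1 C \<pi> by (auto simp: M_def intro!: add_pos_nonneg)
  \<comment> \<open>The summands ensure, for \<open>n \<ge> n1\<close>, that an extremal graph on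
    \<open>n - 1 \<ge> 1\<close> vertices is available, that \<open>r < n\<close>, that
    \<open>C < n\<close> so the entry bound is positive, and that the two size conditions for (1)
    hold.\<close>
  obtain n1 :: nat where n1: "1 + real r + C + real l * real r + real l / (\<alpha> - 1) < real n1"
    using reals_Archimedean2 by blast
  have extremal: "spec_extremal r \<alpha> (Col r (l, E)) n (G n)" if "1 \<le> n" for n
    using assms(5)[OF that] by (simp add: spec_extremal_def)
  have "(1 + real r * (1 - 1 / \<alpha> - real l / (\<alpha> * (real n - real l * real r + real l)))
          * x_min r \<alpha> (G n) powr \<alpha>) * spec_radius r \<alpha> (G n) \<le> spec_radius r \<alpha> (G (n + 1))"
    (is ?A)
    "1 / real n * (1 - \<pi> * M / (real r * real n)) \<le> x_min r \<alpha> (G n) powr \<alpha>" (is ?B)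
    "\<pi> * (1 - M / real n) * real (n choose (r - 1)) \<le> real (min_degree (G n))" (is ?D)
    if n: "n1 \<le> n" for n
  proof -
    have "0 \<le> real l / (\<alpha> - 1)" "0 \<le> real l * real r" using assms(4) by auto
    moreover have "real n1 \<le> real n" using n by simp
    ultimately have nn: "1 + real r < real n" "C < real n" "real l * real r < real n"
      "real l / (\<alpha> - 1) \<le> real n - real l * real r" using n1 C by linarith+
    hence nat: "r < n" "r \<le> n" "1 \<le> n" "1 \<le> n - 1" using assms(1) by auto
    define V where "V = verts (G n)"
    have Gn: "G n \<in> Col r (l, E)" "card V = n" using assms(5)[OF nat(3)] by (auto simp: V_def)
    have rG: "rgraph r (G n)" and ne: "V \<noteq> {}" and fin: "finite V"
      using Gn nat by (auto simp: Col_def V_def rgraph_def)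
    have low: "1 / real n - C / (real n)\<^sup>2 \<le> x v powr \<alpha>"
      if "principal_eigenvector r \<alpha> (G n) x" "v \<in> verts (G n)" for x v
      unfolding C_def using that nat extremal assms
      by (intro principal_eigenvector_entry_ge[where H = "G (n - 1)"]) auto
    define b where "b = 1 / real n - C / (real n)\<^sup>2"
    have b0: "0 < b"
    proof -
      have "C / (real n)\<^sup>2 < real n / (real n)\<^sup>2" using nn nat by (intro divide_strict_right_mono) auto
      thus ?thesis using nat by (simp add: b_def power2_eq_square)
    qed
    have xpos: "b powr (1 / \<alpha>) \<le> x v"
      if "principal_eigenvector r \<alpha> (G n) x" "v \<in> verts (G n)" for x v
    proof -
      have "b powr (1 / \<alpha>) \<le> (x v powr \<alpha>) powr (1 / \<alpha>)"
        using low[OF that] b0 a0 unfolding b_def[symmetric] by (intro powr_mono2) auto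
      also have "\<dots> = x v" using that a0 by (simp add: powr_powr principal_eigenvector_def)
      finally show ?thesis .
    qed
    have xm: "b powr (1 / \<alpha>) \<le> x_min r \<alpha> (G n)"
      using xpos by (intro x_min_bounds(2)[OF rG _ a0]) (use ne V_def in auto)
    hence xm0: "0 \<le> x_min r \<alpha> (G n)" by (rule order_trans[rotated]) simp
    have "(b powr (1 / \<alpha>)) powr \<alpha> \<le> x_min r \<alpha> (G n) powr \<alpha>"
      using xm a0 by (intro powr_mono2) auto
    hence bx: "b \<le> x_min r \<alpha> (G n) powr \<alpha>" using a0 b0 by (simp add: powr_powr)
    have "real r * C \<le> \<pi> * M" using M0(3) \<pi> by (simp add: divide_le_eq mult.commute)
    hence "C \<le> \<pi> * M / real r" using assms(1) by (simp add: pos_le_divide_eq mult.commute)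
    hence "C / (real n)\<^sup>2 \<le> \<pi> * M / real r / (real n)\<^sup>2" by (intro divide_right_mono) auto
    hence "1 / real n * (1 - \<pi> * M / (real r * real n)) \<le> b"
      by (simp add: b_def power2_eq_square right_diff_distrib mult_ac)
    thus ?B using bx by simp
    obtain x where x: "principal_eigenvector r \<alpha> (G n) x"
      using exists_principal_eigenvector[OF rG _ a0] ne by (auto simp: V_def)
    have xp: "0 < x v" if "v \<in> verts (G n)" for v
    proof (rule less_le_trans[OF _ xpos[OF x that]])
      show "0 < b powr (1 / \<alpha>)" using b0 by simp
    qed
    have "x_min r \<alpha> (G n) powr \<alpha> \<le> x v powr \<alpha>" if "v \<in> verts (G n)" for v
      using x_min_bounds(1)[OF rG _ a0 x that] ne xm0 a0 by (intro powr_mono2) (auto simp: V_def)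
    thus ?A
      using spec_radius_fam_growth[OF assms(2,3,1,4) nn(3,4) extremal[OF nat(3)] x xp,
          of "x_min r \<alpha> (G n) powr \<alpha>"] assms(5)[of n] assms(5)[of "n + 1"] nat by simp
    have "\<pi> * (1 - M / real n) * real (n choose k) \<le> real (vdegree (G n) v)" if v: "v \<in> V" for v
    proof -
      have "\<pi> * (1 - M / real n) * real (n choose k) \<le> \<pi> * (1 - M1 / real n) * real (n choose k)"
        using \<pi> M0(2) by (intro mult_right_mono mult_left_mono diff_left_mono divide_right_mono) auto
      also have "\<dots> \<le> real (vdegree (G n) v)"
        unfolding M1_def \<pi>_def k_def
        using vdegree_ge[OF assms(2,3,1,4) nat(2) nn(2) C extremal[OF nat(3)] x low[OF x]] v
        by (simp add: V_def)
      finally show ?thesis .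
    qed
    moreover have "min_degree (G n) \<in> vdegree (G n) ` V"
      unfolding min_degree_def V_def[symmetric] using fin ne by (intro Min_in) auto
    ultimately show ?D by (auto simp: k_def)
  qed
  thus ?thesis using M0(1) unfolding \<pi>_def by blast
qed

end
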